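(* Let $k$ be an algebraically closed field of characteristic zero, let $H$ be a Hopf algebra over $k$ and let $G=G(H)$ be the group of grouplike elements of $H$. Then there is a natural action of $G$ (by graded algebra automorphisms) on the primitive cohomology ring $\mathfrak P(H)$ and on the connected cohomology ring $\mathfrak P_1(H)$, namely the action induced by conjugation on the defining complexes.
   Context: Let $D$ be a subbialgebra of $H$. Let $T_{1,D}(H)$ be the graded vector space with $T_{1,D}(H)^n=H^{\otimes n}\otimes D$ for $n\ge0$; write $f\boxtimes c$ for $f\otimes c$ with $f\in H^{\otimes n}$, $c\in D$. The differential is $$\partial(f\boxtimes c)=(1\otimes f)\boxtimes c-D_n(f)\boxtimes c+(-1)^{n+1}\sum(f\otimes c_1)\boxtimes c_2,$$ where $D_0=0$, $D_n=\sum_{i=0}^{n-1}(-1)^i\,Id^{\otimes i}\otimes\Delta\otimes Id^{\otimes(n-i-1)}$ for $n\ge1$, and $\Delta(c)=\sum c_1\otimes c_2$. The product of $f\boxtimes c\in T_{1,D}(H)^n$ and $g\boxtimes d\in T_{1,D}(H)^m$ is $$(f\boxtimes c)\odot(g\boxtimes d)=\sum\bigl(f\otimes(c_1\otimes\cdots\otimes c_m)g\bigr)\boxtimes c_{m+1}d,$$ with $\sum c_1\otimes\cdots\otimes c_{m+1}$ the iterated coproduct of $c$. With these, $T_{1,D}(H)$ is a dg algebra; its cohomology algebra is denoted $\mathfrak P_D(H)$. The primitive cohomology ring is $\mathfrak P(H)=\mathfrak P_{kG}(H)$ (case $D=kG$) and the connected cohomology ring is $\mathfrak P_1(H)=\mathfrak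 P_k(H)$ (case $D=k$); both are graded by the cohomological degree $n$. Conjugation: $a\in G$ acts on $T_{1,D}(H)^n$ ($D=kG$ or $k$) by $f_1\otimes\cdots\otimes f_n\boxtimes c\mapsto af_1a^{-1}\otimes\cdots\otimes af_na^{-1}\boxtimes aca^{-1}$. *)

theory Defs
  imports
    "HOL-Computational_Algebra.Polynomial"
    "HOL-Library.Poly_Mapping"
    "HOL-Library.Set_Algebras"
    "HOL-Algebra.QuotRing"
    "HOL-Algebra.Group_Action"
begin

text \<open>
  The algebra underlying H is the ring type 'h (which has 0 different from 1, as forced by the
  counit); the scalar action and the coalgebra structure are collected in a record.  All tensor
  powers of H live in one type: a tensor is a coset, in the free vector space on lists over H,
  of the subspace generated by the multilinearity relations.  Lists of length n account for
  the n-th tensor power, so the quotient of the whole free space is the direct sum of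
  all the tensor powers.
\<close>

type_synonym ('k, 'h) tensor = "('h list \<Rightarrow>\<^sub>0 'k) set"

record (overloaded) ('k, 'h) hopf_data =
  scal :: "'k \<Rightarrow> 'h \<Rightarrow> 'h"
  comult :: "'h \<Rightarrow> ('k, 'h) tensor"
  counit :: "'h \<Rightarrow> 'k"
  antipode :: "'h \<Rightarrow> 'h"


definition fscale :: "'k::field \<Rightarrow> ('b \<Rightarrow>\<^sub>0 'k) \<Rightarrow> ('b \<Rightarrow>\<^sub>0 'k)" where
  "fscale c x = Poly_Mapping.map (\<lambda>r. c * r) x"

definition gen :: "'b \<Rightarrow> ('b \<Rightarrow>\<^sub>0 'k::field)" where
  "gen l = Poly_Mapping.single l 1"

definition multilinear_relators :: "('k::field, 'h::ring_1) hopf_data \<Rightarrow> ('h list \<Rightarrow>\<^sub>0 'k) set" where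
  "multilinear_relators H =
     {gen (xs @ [u + v] @ ys) - gen (xs @ [u] @ ys) - gen (xs @ [v] @ ys) | xs u v ys. True} \<union>
     {gen (xs @ [scal H c u] @ ys) - fscale c (gen (xs @ [u] @ ys)) | xs c u ys. True}"

text \<open>The subspace of relations; it is also the zero tensor.\<close>

definition tzero :: "('k::field, 'h::ring_1) hopf_data \<Rightarrow> ('k, 'h) tensor" where
  "tzero H = module.span fscale (multilinear_relators H)"

text \<open>For a list [h1, ..., hn] this is the tensor of h1, ..., hn; for [] it is the
  unit of the ground field, the tensor power of degree 0.\<close>

definition pure :: "('k::field, 'h::ring_1) hopf_data \<Rightarrow> 'h list \<Rightarrow> ('k, 'h) tensor" where
  "pure H l = gen l +o tzero H"

text \<open>The subspace spanned by the pure tensors of the lists in a given set.\<close>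

definition tensors :: "('k::field, 'h::ring_1) hopf_data \<Rightarrow> 'h list set \<Rightarrow> ('k, 'h) tensor set" where
  "tensors H L = {x +o tzero H | x. Poly_Mapping.keys x \<subseteq> L}"

text \<open>Tensors are added by \<open>+\<close> on sets.\<close>

definition tscale :: "('k::field, 'h::ring_1) hopf_data \<Rightarrow> 'k \<Rightarrow> ('k, 'h) tensor \<Rightarrow> ('k, 'h) tensor" where
  "tscale H c X = (\<Union>x\<in>X. fscale c x +o tzero H)"

text \<open>
  The (bi)linear map on tensors with prescribed values on pure tensors.  The prescribed values
  always depend multilinearly on the entries of the list (for each fixed length), so each
  member of the union below is the same coset.  The leading \<open>tzero\<close> matters only for the
  empty sum, which as a sum of sets is \<open>{0}\<close>.
\<close>

definition tlin :: "('k::field, 'h::ring_1) hopf_data \<Rightarrow> ('h list \<Rightarrow> ('k, 'h) tensor)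
    \<Rightarrow> ('k, 'h) tensor \<Rightarrow> ('k, 'h) tensor" where
  "tlin H \<phi> X = (\<Union>x\<in>X. tzero H +
     (\<Sum>l\<in>Poly_Mapping.keys x. tscale H (Poly_Mapping.lookup x l) (\<phi> l)))"

definition tbilin :: "('k::field, 'h::ring_1) hopf_data \<Rightarrow> ('h list \<Rightarrow> 'h list \<Rightarrow> ('k, 'h) tensor)
    \<Rightarrow> ('k, 'h) tensor \<Rightarrow> ('k, 'h) tensor \<Rightarrow> ('k, 'h) tensor" where
  "tbilin H \<phi> X Y = tlin H (\<lambda>l. tlin H (\<phi> l) Y) X"

text \<open>The juxtaposition of tensors, from degrees m and n to degree m + n.\<close>

definition tprod :: "('k::field, 'h::ring_1) hopf_data
    \<Rightarrow> ('k, 'h) tensor \<Rightarrow> ('k, 'h) tensor \<Rightarrow> ('k, 'h) tensor" where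
  "tprod H = tbilin H (\<lambda>l l'. pure H (l @ l'))"

text \<open>The product of the algebra structure on each tensor power.\<close>

definition tmult :: "('k::field, 'h::ring_1) hopf_data
    \<Rightarrow> ('k, 'h) tensor \<Rightarrow> ('k, 'h) tensor \<Rightarrow> ('k, 'h) tensor" where
  "tmult H = tbilin H (\<lambda>l l'. if length l = length l' then pure H (map2 (*) l l') else tzero H)"

text \<open>\<open>Id\<^bsup>\<otimes>i\<^esup> \<otimes> \<Delta> \<otimes> Id \<otimes> \<dots> \<otimes> Id\<close> on a pure tensor.\<close>

definition comult_at :: "('k::field, 'h::ring_1) hopf_data \<Rightarrow> nat \<Rightarrow> 'h list \<Rightarrow> ('k, 'h) tensor" where
  "comult_at H i l =
     (if i < length l
      then tprod H (pure H (take i l)) (tprod H (comult H (l ! i)) (pure H (drop (Suc i) l)))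
      else tzero H)"


text \<open>H itself is identified with its first tensor power by \<open>h \<mapsto> pure H [h]\<close>.\<close>

locale hopf_algebra = vector_space "scal H"
  for H :: "('k::field, 'h::ring_1) hopf_data" +
  assumes scal_mult_left: "scal H c (x * y) = scal H c x * y"
    and scal_mult_right: "scal H c (x * y) = x * scal H c y"
    and comult_closed: "comult H x \<in> tensors H {l. length l = 2}"
    and comult_add: "comult H (x + y) = comult H x + comult H y"
    and comult_scal: "comult H (scal H c x) = tscale H c (comult H x)"
    and counit_add: "counit H (x + y) = counit H x + counit H y"
    and counit_scal: "counit H (scal H c x) = c * counit H x"
    and coassoc: "tlin H (comult_at H 0) (comult H x) = tlin H (comult_at H 1) (comult H x)"
    and counit_left: "tlin H (\<lambda>l. case l of [u, v] \<Rightarrow> tscale H (counit H u) (pure H [v])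
          | _ \<Rightarrow> tzero H) (comult H x) = pure H [x]"
    and counit_right: "tlin H (\<lambda>l. case l of [u, v] \<Rightarrow> tscale H (counit H v) (pure H [u])
          | _ \<Rightarrow> tzero H) (comult H x) = pure H [x]"
    and comult_one: "comult H 1 = pure H [1, 1]"
    and comult_mult: "comult H (x * y) = tmult H (comult H x) (comult H y)"
    and counit_one: "counit H 1 = 1"
    and counit_mult: "counit H (x * y) = counit H x * counit H y"
    and antipode_add: "antipode H (x + y) = antipode H x + antipode H y"
    and antipode_scal: "antipode H (scal H c x) = scal H c (antipode H x)"
    and antipode_left: "tlin H (\<lambda>l. case l of [u, v] \<Rightarrow> pure H [antipode H u * v]
          | _ \<Rightarrow> tzero H) (comult H x) = pure H [scal H (counit H x) 1]"
    and antipode_right: "tlin H (\<lambda>l. case l of [u, v] \<Rightarrow> pure H [u * antipode H v]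
          | _ \<Rightarrow> tzero H) (comult H x) = pure H [scal H (counit H x) 1]"

definition grouplikes :: "('k::field, 'h::ring_1) hopf_data \<Rightarrow> 'h set" where
  "grouplikes H = {a. a \<noteq> 0 \<and> comult H a = pure H [a, a]}"

definition grouplike_group :: "('k::field, 'h::ring_1) hopf_data \<Rightarrow> 'h monoid" where
  "grouplike_group H = \<lparr>carrier = grouplikes H, mult = (*), one = 1\<rparr>"

definition grouplike_algebra :: "('k::field, 'h::ring_1) hopf_data \<Rightarrow> 'h set" where
  "grouplike_algebra H = module.span (scal H) (grouplikes H)"

definition ground_algebra :: "('k::field, 'h::ring_1) hopf_data \<Rightarrow> 'h set" where
  "ground_algebra H = range (\<lambda>c. scal H c 1)"


text \<open>
  As we work over a field, the tensor product of the n-th tensor power of H with D is identified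
  with its image in the (n+1)-st tensor power of H: the list \<open>f @ [c]\<close> with c in D stands for
  \<open>f \<boxtimes> c\<close>.
\<close>

definition T_degree :: "('k::field, 'h::ring_1) hopf_data \<Rightarrow> 'h set \<Rightarrow> nat \<Rightarrow> ('k, 'h) tensor set" where
  "T_degree H D n = tensors H {f @ [c] | f c. length f = n \<and> c \<in> D}"

definition D_op :: "('k::field, 'h::ring_1) hopf_data \<Rightarrow> 'h list \<Rightarrow> ('k, 'h) tensor" where
  "D_op H f = tzero H + (\<Sum>i<length f. tscale H ((-1) ^ i) (comult_at H i f))"

definition diff_pure :: "('k::field, 'h::ring_1) hopf_data \<Rightarrow> 'h list \<Rightarrow> 'h \<Rightarrow> ('k, 'h) tensor" where
  "diff_pure H f c =
     pure H ([1] @ f @ [c])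
     + tscale H (-1) (tprod H (D_op H f) (pure H [c]))
     + tscale H ((-1) ^ (length f + 1)) (tprod H (pure H f) (comult H c))"

definition T_diff :: "('k::field, 'h::ring_1) hopf_data \<Rightarrow> ('k, 'h) tensor \<Rightarrow> ('k, 'h) tensor" where
  "T_diff H = tlin H (\<lambda>l. diff_pure H (butlast l) (last l))"

text \<open>The iterated coproduct, with m + 1 tensor factors.\<close>

fun iter_comult :: "('k::field, 'h::ring_1) hopf_data \<Rightarrow> nat \<Rightarrow> 'h \<Rightarrow> ('k, 'h) tensor" where
  "iter_comult H 0 c = pure H [c]"
| "iter_comult H (Suc m) c = tlin H (comult_at H 0) (iter_comult H m c)"

text \<open>
  For g of length m, the factors \<open>(c\<^sub>1 \<otimes> \<dots> \<otimes> c\<^sub>m)g\<close> and \<open>c\<^bsub>m+1\<^esub>d\<close> together make up the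
  product of the iterated coproduct of c with \<open>g \<otimes> d\<close> in the (m+1)-st tensor power.
\<close>

definition odot_pure :: "('k::field, 'h::ring_1) hopf_data \<Rightarrow> 'h list \<Rightarrow> 'h \<Rightarrow> 'h list \<Rightarrow> 'h
    \<Rightarrow> ('k, 'h) tensor" where
  "odot_pure H f c g d =
     tprod H (pure H f) (tmult H (iter_comult H (length g) c) (pure H (g @ [d])))"

definition odot :: "('k::field, 'h::ring_1) hopf_data
    \<Rightarrow> ('k, 'h) tensor \<Rightarrow> ('k, 'h) tensor \<Rightarrow> ('k, 'h) tensor" where
  "odot H = tbilin H (\<lambda>l l'. odot_pure H (butlast l) (last l) (butlast l') (last l'))"

definition T_ring :: "('k::field, 'h::ring_1) hopf_data \<Rightarrow> 'h set \<Rightarrow> ('k, 'h) tensor ring" where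
  "T_ring H D = \<lparr>carrier = tensors H {f @ [c] | f c. c \<in> D},
     mult = odot H, one = pure H [1], zero = tzero H, add = (+)\<rparr>"

definition cocycles :: "('k::field, 'h::ring_1) hopf_data \<Rightarrow> 'h set \<Rightarrow> ('k, 'h) tensor set" where
  "cocycles H D = {X \<in> carrier (T_ring H D). T_diff H X = tzero H}"

definition coboundaries :: "('k::field, 'h::ring_1) hopf_data \<Rightarrow> 'h set \<Rightarrow> ('k, 'h) tensor set" where
  "coboundaries H D = T_diff H ` carrier (T_ring H D)"

definition cocycle_ring :: "('k::field, 'h::ring_1) hopf_data \<Rightarrow> 'h set \<Rightarrow> ('k, 'h) tensor ring" where
  "cocycle_ring H D = (T_ring H D)\<lparr>carrier := cocycles H D\<rparr>"

text \<open>
  For D = \<open>grouplike_algebra H\<close> this is the primitive cohomology ring of H, and for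
  D = \<open>ground_algebra H\<close> the connected cohomology ring.
\<close>

definition cohomology_ring :: "('k::field, 'h::ring_1) hopf_data \<Rightarrow> 'h set
    \<Rightarrow> ('k, 'h) tensor set ring" where
  "cohomology_ring H D = cocycle_ring H D Quot coboundaries H D"

definition cohomology_class :: "('k::field, 'h::ring_1) hopf_data \<Rightarrow> 'h set
    \<Rightarrow> ('k, 'h) tensor \<Rightarrow> ('k, 'h) tensor set" where
  "cohomology_class H D X = coboundaries H D +>\<^bsub>cocycle_ring H D\<^esub> X"

definition cohomology_scale :: "('k::field, 'h::ring_1) hopf_data \<Rightarrow> 'h set \<Rightarrow> 'k
    \<Rightarrow> ('k, 'h) tensor set \<Rightarrow> ('k, 'h) tensor set" where
  "cohomology_scale H D c \<xi> = (\<Union>X\<in>\<xi>. cohomology_class H D (tscale H c X))"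

definition cohomology_degree :: "('k::field, 'h::ring_1) hopf_data \<Rightarrow> 'h set \<Rightarrow> nat
    \<Rightarrow> ('k, 'h) tensor set set" where
  "cohomology_degree H D n = cohomology_class H D ` (cocycles H D \<inter> T_degree H D n)"

definition graded_algebra_automorphism :: "('k::field, 'h::ring_1) hopf_data \<Rightarrow> 'h set
    \<Rightarrow> (('k, 'h) tensor set \<Rightarrow> ('k, 'h) tensor set) \<Rightarrow> bool" where
  "graded_algebra_automorphism H D \<theta> \<longleftrightarrow>
     \<theta> \<in> ring_iso (cohomology_ring H D) (cohomology_ring H D) \<and>
     (\<forall>c. \<forall>\<xi>\<in>carrier (cohomology_ring H D).
        \<theta> (cohomology_scale H D c \<xi>) = cohomology_scale H D c (\<theta> \<xi>)) \<and>
     (\<forall>n. \<theta> ` cohomology_degree H D n = cohomology_degree H D n)"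


definition conj_tensor :: "('k::field, 'h::ring_1) hopf_data \<Rightarrow> 'h
    \<Rightarrow> ('k, 'h) tensor \<Rightarrow> ('k, 'h) tensor" where
  "conj_tensor H a = tlin H (\<lambda>l. pure H (map (\<lambda>x. a * x * inv\<^bsub>grouplike_group H\<^esub> a) l))"

text \<open>The map induced on cohomology: the class of a cocycle X goes to the class of its conjugate.\<close>

definition conj_cohomology :: "('k::field, 'h::ring_1) hopf_data \<Rightarrow> 'h set \<Rightarrow> 'h
    \<Rightarrow> ('k, 'h) tensor set \<Rightarrow> ('k, 'h) tensor set" where
  "conj_cohomology H D a \<xi> = (\<Union>X\<in>\<xi>. cohomology_class H D (conj_tensor H a X))"

end

theory Submission
  imports Defs
begin

text \<open>
  Conjugation by a grouplike element \<open>a\<close>, whose inverse is \<open>S(a)\<close>, is an automorphism of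
  the bialgebra \<open>H\<close>: it is multiplicative because \<open>S(a)a = 1\<close>, and it respects the
  coproduct because \<open>\<Delta>(axS(a)) = (a \<otimes> a)\<Delta>(x)(S(a) \<otimes> S(a))\<close>.  The differential and the product
  of \<open>T\<^sub>1\<^sub>,\<^sub>D(H)\<close> are put together from the unit, the product and the coproduct of \<open>H\<close> alone, so
  every bialgebra endomorphism \<open>\<tau>\<close>, applied to each tensor factor, commutes with both
  (\<open>tmap_T_diff\<close> and \<open>tmap_odot\<close>).  If moreover \<open>\<tau>\<close> maps \<open>D\<close> into itself, it preserves each
  degree, the cocycles and the coboundaries, and so induces a map on cohomology.  For an
  invertible \<open>\<tau>\<close> this map is a graded algebra automorphism (\<open>induced_automorphism\<close>), and
  \<open>\<tau> \<mapsto> induced H D \<tau>\<close> respects composition, which turns conjugation into a group action.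
  Both choices of \<open>D\<close> are stable under conjugation: grouplike elements are
  permuted, scalars are fixed.

  The induced map is multiplicative for the following reason: by definition, the product of two
  classes is the union of the classes of all products of representatives, and an automorphism of
  the complex carries the representatives of a class onto the representatives of its image
  (\<open>tmap_class_image\<close>).

  The calculations rest on one principle: a tensor is a sum of pure tensors, so two linear maps
  that agree on pure tensors are equal (\<open>tlinear_eqI\<close>, \<open>tbilinear_eqI\<close>).  To use it, each
  operation defined by its values on pure tensors has to be shown well defined and linear, which
  \<open>multilinear_tlin\<close> and \<open>bimultilinear_tbilin\<close> reduce to multilinearity of the values.
\<close>

section \<open>Free vector spaces and their linear maps\<close>

lemma lookup_fscale: "Poly_Mapping.lookup (fscale c x) l = c * Poly_Mapping.lookup x l"
  by (simp add: fscale_def map.rep_eq when_def)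

interpretation free: vector_space "fscale :: 'k::field \<Rightarrow> ('b \<Rightarrow>\<^sub>0 'k) \<Rightarrow> ('b \<Rightarrow>\<^sub>0 'k)"
  by unfold_locales (auto intro!: poly_mapping_eqI simp: lookup_fscale lookup_add algebra_simps)

definition lin_ext :: "('k::field \<Rightarrow> 'v::ab_group_add \<Rightarrow> 'v) \<Rightarrow> ('b \<Rightarrow> 'v) \<Rightarrow> ('b \<Rightarrow>\<^sub>0 'k) \<Rightarrow> 'v" where
  "lin_ext s \<psi> x = (\<Sum>l\<in>Poly_Mapping.keys x. s (Poly_Mapping.lookup x l) (\<psi> l))"

context vector_space
begin

lemma lin_ext_superset:
  assumes "finite A" "Poly_Mapping.keys x \<subseteq> A"
  shows "lin_ext scale \<psi> x = (\<Sum>l\<in>A. scale (Poly_Mapping.lookup x l) (\<psi> l))"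
  unfolding lin_ext_def
  by (rule sum.mono_neutral_left) (use assms in \<open>auto simp: in_keys_iff\<close>)

lemma lin_ext_add: "lin_ext scale \<psi> (x + y) = lin_ext scale \<psi> x + lin_ext scale \<psi> y"
proof -
  let ?A = "Poly_Mapping.keys x \<union> Poly_Mapping.keys y"
  have "lin_ext scale \<psi> (x + y) = (\<Sum>l\<in>?A. scale (Poly_Mapping.lookup (x + y) l) (\<psi> l))"
    by (rule lin_ext_superset) (auto simp: Poly_Mapping.keys_add)
  also have "\<dots> = lin_ext scale \<psi> x + lin_ext scale \<psi> y"
    by (simp add: lin_ext_superset[of ?A] lookup_add scale_left_distrib sum.distrib)
  finally show ?thesis .
qed

lemma lin_ext_scale: "lin_ext scale \<psi> (fscale c x) = scale c (lin_ext scale \<psi> x)"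
proof -
  have "Poly_Mapping.keys (fscale c x) \<subseteq> Poly_Mapping.keys x"
    by (auto simp: in_keys_iff lookup_fscale)
  then show ?thesis
    by (simp add: lin_ext_superset[of "Poly_Mapping.keys x"] lookup_fscale scale_sum_right)
qed

lemma lin_ext_zero: "lin_ext scale \<psi> 0 = 0"
  by (simp add: lin_ext_def)

lemma lin_ext_diff: "lin_ext scale \<psi> (x - y) = lin_ext scale \<psi> x - lin_ext scale \<psi> y"
  using lin_ext_add[of \<psi> "x - y" y] by (simp add: algebra_simps)

lemma lin_ext_gen: "lin_ext scale \<psi> (gen l) = \<psi> l"
  by (simp add: lin_ext_def gen_def)

end

lemma lin_ext_gen_self: "lin_ext fscale gen x = x"
  unfolding lin_ext_def
  by (rule poly_mapping_eqI)
    (simp add: lookup_sum lookup_fscale gen_def lookup_single when_def in_keys_iff if_distrib[where f = "(*) _"] cong: if_cong)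

section \<open>Tensors as cosets\<close>

definition tclass :: "('k::field, 'h::ring_1) hopf_data \<Rightarrow> ('h list \<Rightarrow>\<^sub>0 'k) \<Rightarrow> ('k, 'h) tensor" where
  "tclass H x = x +o tzero H"

abbreviation all_tensors :: "('k::field, 'h::ring_1) hopf_data \<Rightarrow> ('k, 'h) tensor set" where
  "all_tensors H \<equiv> tensors H UNIV"

lemma tzero_closed [simp]:
  shows "0 \<in> tzero H"
    and "x \<in> tzero H \<Longrightarrow> y \<in> tzero H \<Longrightarrow> x + y \<in> tzero H"
    and "x \<in> tzero H \<Longrightarrow> y \<in> tzero H \<Longrightarrow> x - y \<in> tzero H"
    and "x \<in> tzero H \<Longrightarrow> - x \<in> tzero H"
    and "x \<in> tzero H \<Longrightarrow> fscale c x \<in> tzero H"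
  unfolding tzero_def
  by (simp_all add: free.span_zero free.span_add free.span_diff free.span_neg free.span_scale)

lemma in_tclass: "y \<in> tclass H x \<longleftrightarrow> y - x \<in> tzero H"
  unfolding tclass_def elt_set_plus_def by (auto intro: bexI[of _ "y - x"])

lemma tclass_eq_iff: "tclass H x = tclass H y \<longleftrightarrow> x - y \<in> tzero H"
proof
  assume "tclass H x = tclass H y"
  moreover have "x \<in> tclass H x" by (simp add: in_tclass)
  ultimately show "x - y \<in> tzero H" by (simp add: in_tclass)
next
  assume *: "x - y \<in> tzero H"
  show "tclass H x = tclass H y"
  proof (intro Set.set_eqI iffI)
    fix z assume "z \<in> tclass H x"
    then have "(z - x) + (x - y) \<in> tzero H" using tzero_closed(2)[OF _ *] by (simp only: in_tclass)
    then show "z \<in> tclass H y" by (simp add: in_tclass)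
  next
    fix z assume "z \<in> tclass H y"
    then have "(z - y) - (x - y) \<in> tzero H" using tzero_closed(3)[OF _ *] by (simp only: in_tclass)
    then show "z \<in> tclass H x" by (simp add: in_tclass)
  qed
qed

lemma tclass_zero: "tclass H 0 = tzero H"
  by (auto simp: in_tclass)

lemma tclass_add: "tclass H x + tclass H y = tclass H (x + y)"
proof (intro Set.set_eqI iffI)
  fix z assume "z \<in> tclass H x + tclass H y"
  then obtain u v where "z = u + v" "u - x \<in> tzero H" "v - y \<in> tzero H"
    by (auto simp: in_tclass elim!: set_plus_elim)
  then have "(u - x) + (v - y) \<in> tzero H" by (intro tzero_closed(2))
  then show "z \<in> tclass H (x + y)" using \<open>z = u + v\<close> by (simp add: in_tclass algebra_simps)
next
  fix z assume "z \<in> tclass H (x + y)"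
  then have "z - x \<in> tclass H y" by (simp add: in_tclass algebra_simps)
  moreover have "x \<in> tclass H x" by (simp add: in_tclass)
  ultimately have "x + (z - x) \<in> tclass H x + tclass H y" by (intro set_plus_intro)
  then show "z \<in> tclass H x + tclass H y" by simp
qed

lemma tscale_tclass: "tscale H c (tclass H x) = tclass H (fscale c x)"
proof -
  have "tclass H (fscale c y) = tclass H (fscale c x)" if "y \<in> tclass H x" for y
    using that by (simp add: in_tclass tclass_eq_iff flip: free.scale_right_diff_distrib)
  moreover have "x \<in> tclass H x" by (simp add: in_tclass)
  ultimately show ?thesis unfolding tscale_def tclass_def[symmetric] by blast
qed

lemma pure_tclass: "pure H l = tclass H (gen l)"
  by (simp add: pure_def tclass_def)

lemma tensors_tclass: "tensors H L = {tclass H x | x. Poly_Mapping.keys x \<subseteq> L}"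
  by (simp add: tensors_def tclass_def)

lemma tensors_mono: "L \<subseteq> L' \<Longrightarrow> tensors H L \<subseteq> tensors H L'"
  unfolding tensors_tclass by blast

lemma tensors_all: "X \<in> tensors H L \<Longrightarrow> X \<in> all_tensors H"
  using tensors_mono[of L UNIV H] by auto

lemma all_tensorsE:
  assumes "X \<in> all_tensors H" obtains x where "X = tclass H x"
  using assms by (auto simp: tensors_tclass)

lemma tclass_tensor [simp]: "tclass H x \<in> all_tensors H"
  by (auto simp: tensors_tclass)

lemma tzero_tensor [simp]: "tzero H \<in> tensors H L"
  unfolding tensors_tclass tclass_zero[symmetric] by (rule CollectI) (rule exI[of _ 0], simp)

lemma tensors_add [simp]: "X \<in> tensors H L \<Longrightarrow> Y \<in> tensors H L \<Longrightarrow> X + Y \<in> tensors H L"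
  unfolding tensors_tclass using Poly_Mapping.keys_add by (fastforce simp: tclass_add)

lemma tensors_scale [simp]: "X \<in> tensors H L \<Longrightarrow> tscale H c X \<in> tensors H L"
proof -
  have "Poly_Mapping.keys (fscale c x) \<subseteq> Poly_Mapping.keys x" for x
    by (auto simp: in_keys_iff lookup_fscale)
  then show "X \<in> tensors H L \<Longrightarrow> tscale H c X \<in> tensors H L"
    unfolding tensors_tclass by (fastforce simp: tscale_tclass)
qed

lemma pure_tensor [simp]: "l \<in> L \<Longrightarrow> pure H l \<in> tensors H L"
  unfolding tensors_tclass pure_tclass
  by (rule CollectI) (rule exI[of _ "gen l"], simp add: gen_def)

lemma tzero_add [simp]:
  assumes "X \<in> all_tensors H" shows "tzero H + X = X" and "X + tzero H = X"
  using assms by (auto elim!: all_tensorsE simp: tclass_add simp flip: tclass_zero)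

lemma tscale_laws:
  assumes "X \<in> all_tensors H"
  shows tscale_tscale: "tscale H c (tscale H d X) = tscale H (c * d) X"
    and tscale_neg: "tscale H (-1) X + X = tzero H"
    and tscale_tzero: "tscale H 0 X = tzero H"
  using assms
  by (auto elim!: all_tensorsE simp: tscale_tclass tclass_add simp flip: tclass_zero)

lemma tscale_add:
  "X \<in> all_tensors H \<Longrightarrow> Y \<in> all_tensors H \<Longrightarrow> tscale H c (X + Y) = tscale H c X + tscale H c Y"
  by (elim all_tensorsE) (simp add: tscale_tclass tclass_add free.scale_right_distrib)

lemma tscale_zero [simp]: "tscale H c (tzero H) = tzero H"
  by (simp add: tscale_tclass flip: tclass_zero)

text \<open>
  The sum of an empty family of cosets is \<open>{0}\<close>, which is not a coset in general; the summand
  \<open>tzero H\<close> turns it into the zero tensor and is absorbed by every nonempty sum.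
\<close>

lemma tzero_sum:
  assumes "finite A" "\<And>i. i \<in> A \<Longrightarrow> f i = tclass H (g i)"
  shows "tzero H + (\<Sum>i\<in>A. f i) = tclass H (\<Sum>i\<in>A. g i)"
  using assms
proof (induction A rule: finite_induct)
  case empty
  then show ?case by (simp add: tclass_zero)
next
  case (insert i A)
  have "tzero H + (\<Sum>i\<in>insert i A. f i) = f i + (tzero H + (\<Sum>i\<in>A. f i))"
    using insert.hyps by (simp add: ac_simps)
  also have "\<dots> = tclass H (g i) + tclass H (\<Sum>i\<in>A. g i)"
    using insert.IH insert.prems by (metis insertCI)
  also have "\<dots> = tclass H (\<Sum>i\<in>insert i A. g i)"
    using insert.hyps by (simp add: tclass_add)
  finally show ?case .
qed

text \<open>
  A representative of a tensor is a linear combination of lists, so the tensor is the sum of the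
  corresponding multiples of pure tensors.
\<close>

lemma tensor_induct [consumes 1, case_names zero add pure]:
  assumes X: "X \<in> tensors H L"
    and zero: "P (tzero H)"
    and add: "\<And>X Y. X \<in> tensors H L \<Longrightarrow> Y \<in> tensors H L \<Longrightarrow> P X \<Longrightarrow> P Y \<Longrightarrow> P (X + Y)"
    and pure: "\<And>c l. l \<in> L \<Longrightarrow> P (tscale H c (pure H l))"
  shows "P X"
proof -
  from X obtain x where x: "X = tclass H x" "Poly_Mapping.keys x \<subseteq> L" by (auto simp: tensors_tclass)
  have "tclass H (\<Sum>l\<in>A. fscale (Poly_Mapping.lookup x l) (gen l)) \<in> tensors H L
      \<and> P (tclass H (\<Sum>l\<in>A. fscale (Poly_Mapping.lookup x l) (gen l)))"
    if "finite A" "A \<subseteq> L" for A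
    using that
  proof (induction A rule: finite_induct)
    case empty
    then show ?case by (simp add: tclass_zero zero)
  next
    case (insert l A)
    then have "l \<in> L" by simp
    let ?Y = "tscale H (Poly_Mapping.lookup x l) (pure H l)"
    have "?Y \<in> tensors H L" "P ?Y" using pure \<open>l \<in> L\<close> by auto
    then show ?case
      using insert add[of ?Y] tensors_add[of ?Y] by (simp add: pure_tclass tscale_tclass flip: tclass_add)
  qed
  from this[of "Poly_Mapping.keys x"] have "P (tclass H (lin_ext fscale gen x))"
    using x by (simp add: lin_ext_def)
  then show ?thesis by (simp add: x lin_ext_gen_self)
qed

section \<open>Linear and multilinear maps with values in tensors\<close>

definition tlinear :: "('k::field, 'h::ring_1) hopf_data \<Rightarrow> (('k, 'h) tensor \<Rightarrow> ('k, 'h) tensor) \<Rightarrow> bool" where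
  "tlinear H F \<longleftrightarrow> (\<forall>X\<in>all_tensors H. F X \<in> all_tensors H) \<and>
     (\<forall>X\<in>all_tensors H. \<forall>Y\<in>all_tensors H. F (X + Y) = F X + F Y) \<and>
     (\<forall>c. \<forall>X\<in>all_tensors H. F (tscale H c X) = tscale H c (F X))"

text \<open>
  Linearity occurs in three kinds of variables: in a tensor, in an element of \<open>H\<close>, and in each entry of a list.
  The last one is expressed through the second by singling out one entry, so that one
  set of closure rules for \<open>hlinear\<close> serves all slots.
\<close>

definition hlinear :: "('k::field, 'h::ring_1) hopf_data \<Rightarrow> ('h \<Rightarrow> ('k, 'h) tensor) \<Rightarrow> bool" where
  "hlinear H f \<longleftrightarrow> (\<forall>u. f u \<in> all_tensors H) \<and>
     (\<forall>u v. f (u + v) = f u + f v) \<and> (\<forall>c u. f (scal H c u) = tscale H c (f u))"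

definition multilinear :: "('k::field, 'h::ring_1) hopf_data \<Rightarrow> ('h list \<Rightarrow> ('k, 'h) tensor) \<Rightarrow> bool" where
  "multilinear H \<phi> \<longleftrightarrow> \<phi> [] \<in> all_tensors H \<and> (\<forall>xs ys. hlinear H (\<lambda>u. \<phi> (xs @ [u] @ ys)))"

definition tbilinear :: "('k::field, 'h::ring_1) hopf_data
    \<Rightarrow> (('k, 'h) tensor \<Rightarrow> ('k, 'h) tensor \<Rightarrow> ('k, 'h) tensor) \<Rightarrow> bool" where
  "tbilinear H \<beta> \<longleftrightarrow> (\<forall>X\<in>all_tensors H. tlinear H (\<beta> X)) \<and> (\<forall>Y\<in>all_tensors H. tlinear H (\<lambda>X. \<beta> X Y))"

lemma tlinearD:
  assumes "tlinear H F"
  shows "X \<in> all_tensors H \<Longrightarrow> F X \<in> all_tensors H"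
    and "X \<in> all_tensors H \<Longrightarrow> Y \<in> all_tensors H \<Longrightarrow> F (X + Y) = F X + F Y"
    and "X \<in> all_tensors H \<Longrightarrow> F (tscale H c X) = tscale H c (F X)"
  using assms by (auto simp: tlinear_def)

lemma tlinear_zero: "tlinear H F \<Longrightarrow> F (tzero H) = tzero H"
  using tlinearD(3)[of H F "tzero H" 0] tlinearD(1)[of H F "tzero H"] by (simp add: tscale_tzero)

lemma hlinearD:
  assumes "hlinear H f"
  shows "f u \<in> all_tensors H" and "f (u + v) = f u + f v" and "f (scal H c u) = tscale H c (f u)"
  using assms by (auto simp: hlinear_def)

lemma multilinear_hlinear: "multilinear H \<phi> \<Longrightarrow> hlinear H (\<lambda>u. \<phi> (xs @ [u] @ ys))"
  by (simp add: multilinear_def)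

lemma multilinear_tensor: "multilinear H \<phi> \<Longrightarrow> \<phi> l \<in> all_tensors H"
proof (cases l)
  case (Cons x xs)
  assume "multilinear H \<phi>"
  from hlinearD(1)[OF multilinear_hlinear[OF this, of "[]"], of x xs] Cons show ?thesis by simp
qed (simp add: multilinear_def)

lemma tbilinearD:
  assumes "tbilinear H \<beta>"
  shows "X \<in> all_tensors H \<Longrightarrow> tlinear H (\<beta> X)" and "Y \<in> all_tensors H \<Longrightarrow> tlinear H (\<lambda>X. \<beta> X Y)"
  using assms by (auto simp: tbilinear_def)

lemma tbilinear_tensor:
  "tbilinear H \<beta> \<Longrightarrow> X \<in> all_tensors H \<Longrightarrow> Y \<in> all_tensors H \<Longrightarrow> \<beta> X Y \<in> all_tensors H"
  by (metis tbilinearD(1) tlinearD(1))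

lemma tlinear_comp: "tlinear H F \<Longrightarrow> tlinear H G \<Longrightarrow> tlinear H (\<lambda>X. F (G X))"
  by (simp add: tlinear_def)

lemma tlinear_id: "tlinear H (\<lambda>X. X)"
  by (simp add: tlinear_def)

lemma hlinear_comp: "tlinear H F \<Longrightarrow> hlinear H f \<Longrightarrow> hlinear H (\<lambda>u. F (f u))"
  by (simp add: tlinear_def hlinear_def)

lemma hlinear_add: "hlinear H f \<Longrightarrow> hlinear H g \<Longrightarrow> hlinear H (\<lambda>u. f u + g u)"
  by (auto simp: hlinear_def tscale_add ac_simps)

lemma tlinear_scale: "tlinear H (tscale H c)"
  by (auto simp: tlinear_def tscale_add tscale_tscale mult.commute)

lemma hlinear_tzero: "hlinear H (\<lambda>u. tzero H)"
  by (simp add: hlinear_def)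

lemma hlinear_sum:
  assumes "\<And>i. i \<in> A \<Longrightarrow> hlinear H (f i)"
  shows "hlinear H (\<lambda>u. tzero H + (\<Sum>i\<in>A. f i u))"
proof (cases "finite A")
  case True
  then show ?thesis using assms
  proof (induction A rule: finite_induct)
    case empty
    then show ?case by (simp add: hlinear_tzero)
  next
    case (insert i A)
    then have "hlinear H (\<lambda>u. f i u + (tzero H + (\<Sum>i\<in>A. f i u)))" by (intro hlinear_add[of H "f i"]) auto
    then show ?case using insert by (simp add: ac_simps)
  qed
qed (simp add: hlinear_tzero)

lemma tlinear_eqI:
  assumes "tlinear H F" "tlinear H G" "\<And>l. l \<in> L \<Longrightarrow> F (pure H l) = G (pure H l)" "X \<in> tensors H L"
  shows "F X = G X"
  using assms(4)
proof (induction X rule: tensor_induct)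
  case zero
  then show ?case using assms by (simp add: tlinear_zero)
next
  case (add X Y)
  then show ?case using assms by (simp add: tlinearD tensors_all)
next
  case (pure c l)
  then show ?case using assms by (simp add: tlinearD)
qed

lemma tlinear_maps_tensors:
  assumes "tlinear H F" "\<And>l. l \<in> L \<Longrightarrow> F (pure H l) \<in> tensors H M" "X \<in> tensors H L"
  shows "F X \<in> tensors H M"
  using assms(3)
proof (induction X rule: tensor_induct)
  case zero
  then show ?case using assms by (simp add: tlinear_zero)
next
  case (add X Y)
  then show ?case using assms by (simp add: tlinearD tensors_all)
next
  case (pure c l)
  then show ?case using assms by (simp add: tlinearD)
qed

lemma tbilinear_eqI:
  assumes "tbilinear H \<beta>" "tbilinear H \<gamma>"
    and eq: "\<And>l m. l \<in> L \<Longrightarrow> m \<in> M \<Longrightarrow> \<beta> (pure H l) (pure H m) = \<gamma> (pure H l) (pure H m)"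
    and "X \<in> tensors H L" "Y \<in> tensors H M"
  shows "\<beta> X Y = \<gamma> X Y"
proof (rule tlinear_eqI[where F = "\<lambda>X. \<beta> X Y" and G = "\<lambda>X. \<gamma> X Y"])
  fix l assume "l \<in> L"
  show "\<beta> (pure H l) Y = \<gamma> (pure H l) Y"
    by (rule tlinear_eqI[where L = M]) (use assms \<open>l \<in> L\<close> in \<open>auto intro: tbilinearD\<close>)
qed (use assms in \<open>auto intro: tbilinearD tensors_all\<close>)

lemma tbilinear_comp_outer: "tlinear H F \<Longrightarrow> tbilinear H \<beta> \<Longrightarrow> tbilinear H (\<lambda>X Y. F (\<beta> X Y))"
  unfolding tbilinear_def by (auto intro: tlinear_comp[of H F])

lemma tbilinear_comp_inner:
  "tlinear H F \<Longrightarrow> tbilinear H \<beta> \<Longrightarrow> tbilinear H (\<lambda>X Y. \<beta> (F X) (F Y))"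
  unfolding tbilinear_def
  by (auto dest: tlinearD(1) intro: tlinear_comp[of H "\<beta> _" F] tlinear_comp[of H "\<lambda>X. \<beta> X _" F])

text \<open>
  Choose representatives \<open>\<psi> l\<close> of the values \<open>\<phi> l\<close>.  The linear extension of \<open>\<psi>\<close> to the free
  space sends the relators, hence the subspace they span, into that subspace; this is what
  multilinearity of \<open>\<phi>\<close> says.  So it descends to cosets, and \<open>tlin H \<phi>\<close> is the descended map.
\<close>

lemma multilinear_tlin:
  assumes "multilinear H \<phi>"
  shows tlinear_tlin: "tlinear H (tlin H \<phi>)"
    and tlin_pure: "tlin H \<phi> (pure H l) = \<phi> l"
proof -
  have "\<exists>x. \<phi> l = tclass H x" for l
    using multilinear_tensor[OF assms, of l] by (rule all_tensorsE) blast
  then obtain \<psi> where \<psi>: "\<And>l. \<phi> l = tclass H (\<psi> l)"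
    by metis
  let ?E = "lin_ext fscale \<psi>"
  have relator: "?E r \<in> tzero H" if "r \<in> multilinear_relators H" for r
    using that unfolding multilinear_relators_def
  proof (elim UnE CollectE exE conjE)
    fix xs u v ys assume r: "r = gen (xs @ [u + v] @ ys) - gen (xs @ [u] @ ys) - gen (xs @ [v] @ ys)"
    have "\<phi> (xs @ [u + v] @ ys) = \<phi> (xs @ [u] @ ys) + \<phi> (xs @ [v] @ ys)"
      using hlinearD(2)[OF multilinear_hlinear[OF assms]] .
    then show ?thesis
      by (simp only: \<psi> tclass_add tclass_eq_iff r diff_diff_add
        free.lin_ext_diff free.lin_ext_add free.lin_ext_gen)
  next
    fix xs c u ys assume r: "r = gen (xs @ [scal H c u] @ ys) - fscale c (gen (xs @ [u] @ ys))"
    have "\<phi> (xs @ [scal H c u] @ ys) = tscale H c (\<phi> (xs @ [u] @ ys))"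
      using hlinearD(3)[OF multilinear_hlinear[OF assms]] .
    then show ?thesis
      by (simp only: \<psi> tscale_tclass tclass_eq_iff r free.lin_ext_diff free.lin_ext_scale free.lin_ext_gen)
  qed
  have span: "?E n \<in> tzero H" if "n \<in> tzero H" for n
    using that[unfolded tzero_def]
    by (induction rule: free.span_induct_alt)
      (auto simp: free.lin_ext_zero free.lin_ext_add free.lin_ext_scale relator)
  \<comment> \<open>Over all representatives of one coset the union in the definition has a single member.\<close>
  have val: "tlin H \<phi> (tclass H x) = tclass H (?E x)" for x
  proof -
    have *: "tzero H + (\<Sum>l\<in>Poly_Mapping.keys y. tscale H (Poly_Mapping.lookup y l) (\<phi> l)) = tclass H (?E y)"
      for y
      unfolding lin_ext_def by (rule tzero_sum) (simp_all add: \<psi> tscale_tclass)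
    have "tclass H (?E y) = tclass H (?E x)" if "y \<in> tclass H x" for y
      using that span by (simp add: in_tclass tclass_eq_iff flip: free.lin_ext_diff)
    moreover have "x \<in> tclass H x" by (simp add: in_tclass)
    ultimately show ?thesis unfolding tlin_def * by blast
  qed
  show "tlinear H (tlin H \<phi>)"
    unfolding tlinear_def
    by (auto elim!: all_tensorsE simp: val tclass_add tscale_tclass free.lin_ext_add free.lin_ext_scale)
  show "tlin H \<phi> (pure H l) = \<phi> l"
    by (simp add: pure_tclass val free.lin_ext_gen \<psi>)
qed

text \<open>
  Linearity in the second argument and well-definedness in the first one follow by induction on
  the other argument, because sums and multiples of multilinear maps are multilinear.
\<close>

lemma bimultilinear_tbilin:
  assumes l: "\<And>m. multilinear H (\<lambda>l. \<phi> l m)" and r: "\<And>l. multilinear H (\<phi> l)"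
  shows tbilinear_tbilin: "tbilinear H (tbilin H \<phi>)"
    and tbilin_pure: "tbilin H \<phi> (pure H l) (pure H m) = \<phi> l m"
proof -
  have lin: "tlinear H (tlin H (\<phi> l))" for l using r by (rule tlinear_tlin)
  have slot: "hlinear H (\<lambda>u. tlin H (\<phi> (xs @ [u] @ ys)) Y)" if "Y \<in> all_tensors H" for xs ys Y
    using that
  proof (induction Y rule: tensor_induct)
    case zero
    then show ?case by (simp add: tlinear_zero[OF lin] hlinear_tzero)
  next
    case (add X Y)
    then show ?case by (simp add: tlinearD[OF lin] hlinear_add)
  next
    case (pure c m)
    then show ?case
      using hlinear_comp[OF tlinear_scale multilinear_hlinear[OF l]]
      by (simp add: tlinearD[OF lin] tlin_pure[OF r])
  qed
  have multi: "multilinear H (\<lambda>l. tlin H (\<phi> l) Y)" if "Y \<in> all_tensors H" for Y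
    using that slot by (simp add: multilinear_def tlinearD[OF lin])
  have left: "tlinear H (\<lambda>X. tbilin H \<phi> X Y)" if "Y \<in> all_tensors H" for Y
    unfolding tbilin_def using tlinear_tlin[OF multi[OF that]] .
  have right: "tlinear H (tbilin H \<phi> X)" if "X \<in> all_tensors H" for X
    using that
  proof (induction X rule: tensor_induct)
    case zero
    show ?case
      using tlinear_zero[OF left] by (simp add: tlinear_def)
  next
    case (add X Y)
    then show ?case
      by (auto simp: tlinear_def tlinearD(2)[OF left] tscale_add ac_simps)
  next
    case (pure c m)
    have "tbilin H \<phi> (tscale H c (pure H m)) Y = tscale H c (tlin H (\<phi> m) Y)" if "Y \<in> all_tensors H" for Y
      using tlinearD(3)[OF left[OF that], of "pure H m" c] that
      by (simp add: tbilin_def tlin_pure[OF multi])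
    then show ?case using tlinear_comp[OF tlinear_scale[of H c] lin[of m]] by (simp add: tlinear_def)
  qed
  show "tbilinear H (tbilin H \<phi>)" unfolding tbilinear_def using left right by blast
  show "tbilin H \<phi> (pure H l) (pure H m) = \<phi> l m"
    unfolding tbilin_def by (subst tlin_pure[OF multi]) (simp_all add: tlin_pure[OF r])
qed

section \<open>The structure maps on tensors\<close>

lemma multilinearI:
  assumes "\<phi> [] \<in> all_tensors H" "\<And>xs ys. hlinear H (\<lambda>u. \<phi> (xs @ [u] @ ys))"
  shows "multilinear H \<phi>"
  using assms by (simp add: multilinear_def)

text \<open>
  The two kinds of relators are additivity and homogeneity in one entry.
\<close>

lemma hlinear_pure: "hlinear H (\<lambda>u. pure H (xs @ [u] @ ys))"
  unfolding hlinear_def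
proof (intro conjI allI)
  fix u v c
  have "gen (xs @ [u + v] @ ys) - gen (xs @ [u] @ ys) - gen (xs @ [v] @ ys) \<in> tzero H"
    unfolding tzero_def multilinear_relators_def by (rule free.span_base) blast
  then show "pure H (xs @ [u + v] @ ys) = pure H (xs @ [u] @ ys) + pure H (xs @ [v] @ ys)"
    by (simp only: pure_tclass tclass_add tclass_eq_iff diff_diff_add)
  have "gen (xs @ [scal H c u] @ ys) - fscale c (gen (xs @ [u] @ ys)) \<in> tzero H"
    unfolding tzero_def multilinear_relators_def by (rule free.span_base) blast
  then show "pure H (xs @ [scal H c u] @ ys) = tscale H c (pure H (xs @ [u] @ ys))"
    by (simp only: pure_tclass tscale_tclass tclass_eq_iff)
qed simp

lemma hlinear_precomp:
  assumes "hlinear H f" "\<And>u v. \<tau> (u + v) = \<tau> u + \<tau> v" "\<And>c u. \<tau> (scal H c u) = scal H c (\<tau> u)"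
  shows "hlinear H (\<lambda>u. f (\<tau> u))"
  using assms by (simp add: hlinear_def)

lemma tprod_bimultilinear:
  "multilinear H (\<lambda>l. pure H (l @ m))" "multilinear H (\<lambda>m. pure H (l @ m))"
  using hlinear_pure[of H _ "_ @ m"] hlinear_pure[of H "l @ _"]
  by (auto intro!: multilinearI)

lemma tbilinear_tprod: "tbilinear H (tprod H)"
  unfolding tprod_def by (intro tbilinear_tbilin tprod_bimultilinear)

lemma tprod_pure: "tprod H (pure H l) (pure H m) = pure H (l @ m)"
  unfolding tprod_def by (intro tbilin_pure tprod_bimultilinear)

lemmas tprod_left = tbilinearD(2)[OF tbilinear_tprod]
lemmas tprod_right = tbilinearD(1)[OF tbilinear_tprod]

lemma tprod_tensors:
  assumes "X \<in> tensors H L" "Y \<in> tensors H M" "\<And>l m. l \<in> L \<Longrightarrow> m \<in> M \<Longrightarrow> l @ m \<in> K"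
  shows "tprod H X Y \<in> tensors H K"
proof (rule tlinear_maps_tensors[where F = "\<lambda>X. tprod H X Y"])
  fix l assume "l \<in> L"
  show "tprod H (pure H l) Y \<in> tensors H K"
    by (rule tlinear_maps_tensors[where F = "tprod H (pure H l)"])
      (use assms \<open>l \<in> L\<close> in \<open>auto simp: tprod_pure tprod_right\<close>)
qed (use assms in \<open>auto intro: tprod_left tensors_all\<close>)

lemma tprod_closed [simp]:
  "X \<in> all_tensors H \<Longrightarrow> Y \<in> all_tensors H \<Longrightarrow> tprod H X Y \<in> all_tensors H"
  by (rule tprod_tensors) auto

text \<open>A factorwise product of lists of equal length is linear in each entry of either list; this
  isolates the entry by which the distinguished one is multiplied.\<close>

lemma split_same_length:
  assumes "length (xs @ [u] @ ys) = length m"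
  obtains xs' v ys' where "m = xs' @ [v] @ ys'" "length xs' = length xs" "length ys' = length ys"
proof
  show "m = take (length xs) m @ [m ! length xs] @ drop (Suc (length xs)) m"
    using assms by (simp add: Cons_nth_drop_Suc)
qed (use assms in auto)

context hopf_algebra
begin

lemma tmult_bimultilinear:
  fixes l m :: "'h list"
  defines "\<phi> \<equiv> \<lambda>l m. if length l = length m then pure H (map2 (*) l m) else tzero H"
  shows "multilinear H (\<lambda>l. \<phi> l m)" and "multilinear H (\<phi> l)"
proof -
  show "multilinear H (\<lambda>l. \<phi> l m)"
  proof (rule multilinearI)
    fix xs ys :: "'h list"
    show "hlinear H (\<lambda>u. \<phi> (xs @ [u] @ ys) m)"
    proof (cases "length (xs @ [undefined] @ ys) = length m")
      case True
      then obtain xs' v ys' where "m = xs' @ [v] @ ys'" "length xs' = length xs" "length ys' = length ys"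
        by (rule split_same_length)
      then have "(\<lambda>u. \<phi> (xs @ [u] @ ys) m) = (\<lambda>u. pure H (map2 (*) xs xs' @ [u * v] @ map2 (*) ys ys'))"
        by (simp add: \<phi>_def)
      moreover have "hlinear H (\<lambda>u. pure H (map2 (*) xs xs' @ [u * v] @ map2 (*) ys ys'))"
        by (rule hlinear_precomp[OF hlinear_pure]) (simp_all add: distrib_right scal_mult_left)
      ultimately show ?thesis by (simp only:)
    qed (simp add: \<phi>_def hlinear_tzero)
  qed (simp add: \<phi>_def)
  show "multilinear H (\<phi> l)"
  proof (rule multilinearI)
    fix xs ys :: "'h list"
    show "hlinear H (\<lambda>u. \<phi> l (xs @ [u] @ ys))"
    proof (cases "length (xs @ [undefined] @ ys) = length l")
      case True
      then obtain xs' v ys' where "l = xs' @ [v] @ ys'" "length xs' = length xs" "length ys' = length ys"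
        by (rule split_same_length)
      then have "(\<lambda>u. \<phi> l (xs @ [u] @ ys)) = (\<lambda>u. pure H (map2 (*) xs' xs @ [v * u] @ map2 (*) ys' ys))"
        by (simp add: \<phi>_def)
      moreover have "hlinear H (\<lambda>u. pure H (map2 (*) xs' xs @ [v * u] @ map2 (*) ys' ys))"
        by (rule hlinear_precomp[OF hlinear_pure]) (simp_all add: distrib_left scal_mult_right)
      ultimately show ?thesis by (simp only:)
    qed (simp add: \<phi>_def hlinear_tzero)
  qed (simp add: \<phi>_def)
qed

lemma tbilinear_tmult: "tbilinear H (tmult H)"
  unfolding tmult_def by (intro tbilinear_tbilin tmult_bimultilinear)

lemma tmult_pure:
  "tmult H (pure H l) (pure H m) = (if length l = length m then pure H (map2 (*) l m) else tzero H)"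
  unfolding tmult_def by (intro tbilin_pure tmult_bimultilinear)

lemmas tmult_left = tbilinearD(2)[OF tbilinear_tmult]
lemmas tmult_right = tbilinearD(1)[OF tbilinear_tmult]

lemma tmult_closed [simp]:
  "X \<in> all_tensors H \<Longrightarrow> Y \<in> all_tensors H \<Longrightarrow> tmult H X Y \<in> all_tensors H"
  by (rule tbilinear_tensor[OF tbilinear_tmult])

lemma comult_tensor [simp]: "comult H x \<in> all_tensors H"
  using comult_closed by (rule tensors_all)

lemma hlinear_comult: "hlinear H (comult H)"
  by (simp add: hlinear_def comult_add comult_scal)

lemma hlinear_pure1: "hlinear H (\<lambda>u. pure H [u])"
  using hlinear_pure[of H "[]" "[]"] by simp

lemma comult_at_closed [simp]: "comult_at H i l \<in> all_tensors H"
  by (simp add: comult_at_def)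

text \<open>
  The distinguished entry lies to the right of the position \<open>i\<close> where \<open>\<Delta>\<close> is applied, at it, or to
  its left, and accordingly is an entry of the third, the second or the first of the juxtaposed
  tensors; beyond the end of the list the value is zero.
\<close>

lemma comult_at_slot: "hlinear H (\<lambda>u. comult_at H i (xs @ [u] @ ys))"
proof -
  consider "i < length xs" | "i = length xs" | "length xs < i" "i < Suc (length xs + length ys)"
    | "i \<ge> Suc (length xs + length ys)" by linarith
  then show ?thesis
  proof cases
    case 1
    have "hlinear H (\<lambda>u. tprod H (pure H (take i xs)) (tprod H (comult H (xs ! i))
        (pure H (drop (Suc i) xs @ [u] @ ys))))"
      by (intro hlinear_comp[OF tprod_right] hlinear_pure) auto
    with 1 show ?thesis by (simp add: comult_at_def nth_append)
  next
    case 2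
    have "hlinear H (\<lambda>u. tprod H (pure H xs) (tprod H (comult H u) (pure H ys)))"
      by (intro hlinear_comp[OF tprod_right] hlinear_comp[OF tprod_left] hlinear_comult) auto
    with 2 show ?thesis by (simp add: comult_at_def)
  next
    case 3
    define j where "j = i - Suc (length xs)"
    have i: "i = Suc (length xs + j)" "j < length ys" using 3 by (auto simp: j_def)
    have "hlinear H (\<lambda>u. tprod H (pure H (xs @ [u] @ take j ys))
        (tprod H (comult H (ys ! j)) (pure H (drop (Suc j) ys))))"
      by (rule hlinear_comp[OF tprod_left hlinear_pure]) auto
    with i show ?thesis by (simp add: comult_at_def nth_append)
  next
    case 4
    then show ?thesis by (simp add: comult_at_def hlinear_tzero)
  qed
qed

lemma multilinear_comult_at: "multilinear H (comult_at H i)"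
  by (rule multilinearI) (simp_all only: comult_at_slot comult_at_closed)

lemma sum_tensor: "(\<And>i. i \<in> A \<Longrightarrow> f i \<in> all_tensors H) \<Longrightarrow> tzero H + (\<Sum>i\<in>A. f i) \<in> all_tensors H"
proof (induction A rule: infinite_finite_induct)
  case (insert i A)
  then have "f i + (tzero H + (\<Sum>i\<in>A. f i)) \<in> all_tensors H" by (intro tensors_add[of "f i"]) auto
  with insert.hyps show ?case by (simp add: ac_simps)
qed simp_all

lemma D_op_closed [simp]: "D_op H f \<in> all_tensors H"
  unfolding D_op_def by (rule sum_tensor) simp

lemma D_op_slot: "hlinear H (\<lambda>u. D_op H (xs @ [u] @ ys))"
  unfolding D_op_def length_append list.size
  by (intro hlinear_sum hlinear_comp[OF tlinear_scale] comult_at_slot)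

lemma diff_pure_closed: "diff_pure H f c \<in> all_tensors H"
  by (simp add: diff_pure_def)

text \<open>
  The distinguished entry is either the last one, where the differential uses the coproduct of
  \<open>H\<close>, or one of the factors in front of it.  On the empty list \<open>last\<close> is an unspecified element
  of \<open>H\<close>, and the value there is an unspecified tensor.
\<close>

lemma diff_pure_multilinear: "multilinear H (\<lambda>l. diff_pure H (butlast l) (last l))"
proof (rule multilinearI)
  fix xs ys :: "'h list"
  show "hlinear H (\<lambda>u. diff_pure H (butlast (xs @ [u] @ ys)) (last (xs @ [u] @ ys)))"
  proof (cases ys rule: rev_cases)
    case Nil
    have "hlinear H (\<lambda>u. diff_pure H xs u)"
      unfolding diff_pure_def
      using hlinear_pure[of H "[1] @ xs" "[]"]
      by (intro hlinear_add hlinear_comp[OF tlinear_scale] hlinear_comp[OF tprod_right]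
          hlinear_comult hlinear_pure1) auto
    then show ?thesis using Nil by simp
  next
    case (snoc zs c)
    have "hlinear H (\<lambda>u. diff_pure H (xs @ [u] @ zs) c)"
      unfolding diff_pure_def length_append list.size
      using hlinear_pure[of H "[1] @ xs" "zs @ [c]"]
      by (intro hlinear_add hlinear_comp[OF tlinear_scale] hlinear_comp[OF tprod_left]
          hlinear_pure D_op_slot) auto
    then show ?thesis using snoc by (simp add: butlast_append)
  qed
qed (rule diff_pure_closed)

lemma tlinear_T_diff: "tlinear H (T_diff H)"
  unfolding T_diff_def by (rule tlinear_tlin[OF diff_pure_multilinear])

lemma T_diff_pure: "T_diff H (pure H (f @ [c])) = diff_pure H f c"
  unfolding T_diff_def by (simp add: tlin_pure[OF diff_pure_multilinear])

lemma iter_comult_linear: "hlinear H (iter_comult H m)"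
proof (induction m)
  case 0
  then show ?case by (simp add: hlinear_pure1)
next
  case (Suc m)
  then show ?case by (simp add: hlinear_comp[OF tlinear_tlin[OF multilinear_comult_at]])
qed

lemma iter_comult_tensor [simp]: "iter_comult H m c \<in> all_tensors H"
  using iter_comult_linear by (rule hlinearD)

lemma odot_pure_closed: "odot_pure H f c g d \<in> all_tensors H"
  by (simp add: odot_pure_def)

lemma odot_pure_bimultilinear:
  "multilinear H (\<lambda>l. odot_pure H (butlast l) (last l) (butlast m) (last m))"
  "multilinear H (\<lambda>m. odot_pure H (butlast l) (last l) (butlast m) (last m))"
proof -
  show "multilinear H (\<lambda>l. odot_pure H (butlast l) (last l) (butlast m) (last m))"
  proof (rule multilinearI)
    fix xs ys :: "'h list"
    have last: "hlinear H (\<lambda>u. odot_pure H xs u g d)" for g d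
      unfolding odot_pure_def
      by (intro hlinear_comp[OF tprod_right] hlinear_comp[OF tmult_left] iter_comult_linear) auto
    have inner: "hlinear H (\<lambda>u. odot_pure H (xs @ [u] @ zs) c g d)" for zs c g d
      unfolding odot_pure_def
      by (intro hlinear_comp[OF tprod_left] hlinear_pure) auto
    show "hlinear H (\<lambda>u. odot_pure H (butlast (xs @ [u] @ ys)) (last (xs @ [u] @ ys)) (butlast m) (last m))"
      using last inner by (cases ys rule: rev_cases) (simp_all add: butlast_append)
  qed (rule odot_pure_closed)
  show "multilinear H (\<lambda>m. odot_pure H (butlast l) (last l) (butlast m) (last m))"
  proof (rule multilinearI)
    fix xs ys :: "'h list"
    have "hlinear H (\<lambda>u. tprod H (pure H f) (tmult H (iter_comult H n c) (pure H (xs @ [u] @ ys))))" for f c n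
      by (intro hlinear_comp[OF tprod_right] hlinear_comp[OF tmult_right] hlinear_pure) auto
    moreover have "odot_pure H f c (butlast (xs @ [u] @ ys)) (last (xs @ [u] @ ys)) =
        tprod H (pure H f) (tmult H (iter_comult H (length xs + length ys) c) (pure H (xs @ [u] @ ys)))" for f c u
      unfolding odot_pure_def by (subst append_butlast_last_id) auto
    ultimately show "hlinear H (\<lambda>u. odot_pure H (butlast l) (last l) (butlast (xs @ [u] @ ys)) (last (xs @ [u] @ ys)))"
      by simp
  qed (rule odot_pure_closed)
qed

lemma tbilinear_odot: "tbilinear H (odot H)"
  unfolding odot_def by (intro tbilinear_tbilin odot_pure_bimultilinear)

lemma odot_pure_pure: "odot H (pure H (f @ [c])) (pure H (g @ [d])) = odot_pure H f c g d"
proof -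
  have "odot H (pure H l) (pure H m) = odot_pure H (butlast l) (last l) (butlast m) (last m)" for l m
    unfolding odot_def by (rule tbilin_pure) (rule odot_pure_bimultilinear)+
  then show ?thesis by simp
qed

lemma odot_closed [simp]:
  "X \<in> all_tensors H \<Longrightarrow> Y \<in> all_tensors H \<Longrightarrow> odot H X Y \<in> all_tensors H"
  by (rule tbilinear_tensor[OF tbilinear_odot])

end

section \<open>Functoriality in the Hopf algebra\<close>

text \<open>
  The map \<open>\<tau> \<otimes> \<dots> \<otimes> \<tau>\<close> on all tensor powers at once.
\<close>

definition tmap :: "('k::field, 'h::ring_1) hopf_data \<Rightarrow> ('h \<Rightarrow> 'h) \<Rightarrow> ('k, 'h) tensor \<Rightarrow> ('k, 'h) tensor" where
  "tmap H \<tau> = tlin H (\<lambda>l. pure H (map \<tau> l))"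

definition scal_linear :: "('k::field, 'h::ring_1) hopf_data \<Rightarrow> ('h \<Rightarrow> 'h) \<Rightarrow> bool" where
  "scal_linear H \<tau> \<longleftrightarrow> (\<forall>u v. \<tau> (u + v) = \<tau> u + \<tau> v) \<and> (\<forall>c u. \<tau> (scal H c u) = scal H c (\<tau> u))"

lemma map_multilinear: "scal_linear H \<tau> \<Longrightarrow> multilinear H (\<lambda>l. pure H (map \<tau> l))"
  using hlinear_precomp[OF hlinear_pure, of \<tau> H "map \<tau> _" "map \<tau> _"]
  by (auto intro!: multilinearI simp: scal_linear_def)

lemma tlinear_tmap: "scal_linear H \<tau> \<Longrightarrow> tlinear H (tmap H \<tau>)"
  unfolding tmap_def by (intro tlinear_tlin map_multilinear)

lemma tmap_pure: "scal_linear H \<tau> \<Longrightarrow> tmap H \<tau> (pure H l) = pure H (map \<tau> l)"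
  unfolding tmap_def by (intro tlin_pure map_multilinear)

lemma tmap_tensors:
  "scal_linear H \<tau> \<Longrightarrow> X \<in> tensors H L \<Longrightarrow> (\<And>l. l \<in> L \<Longrightarrow> map \<tau> l \<in> M) \<Longrightarrow> tmap H \<tau> X \<in> tensors H M"
  by (rule tlinear_maps_tensors[OF tlinear_tmap]) (simp_all add: tmap_pure)

lemma tmap_comp:
  assumes "scal_linear H \<tau>" "scal_linear H \<sigma>" "X \<in> all_tensors H"
  shows "tmap H \<tau> (tmap H \<sigma> X) = tmap H (\<lambda>x. \<tau> (\<sigma> x)) X"
proof (rule tlinear_eqI[where L = UNIV and F = "\<lambda>X. tmap H \<tau> (tmap H \<sigma> X)"])
  have *: "scal_linear H (\<lambda>x. \<tau> (\<sigma> x))" using assms by (simp add: scal_linear_def)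
  show "tlinear H (tmap H (\<lambda>x. \<tau> (\<sigma> x)))" using * by (rule tlinear_tmap)
  show "tlinear H (\<lambda>X. tmap H \<tau> (tmap H \<sigma> X))" using assms
    by (intro tlinear_comp[OF tlinear_tmap tlinear_tmap])
  show "tmap H \<tau> (tmap H \<sigma> (pure H l)) = tmap H (\<lambda>x. \<tau> (\<sigma> x)) (pure H l)" for l
    using assms * by (simp add: tmap_pure comp_def)
qed (rule assms)

lemma tmap_ident: "X \<in> all_tensors H \<Longrightarrow> tmap H (\<lambda>x. x) X = X"
proof (rule tlinear_eqI[where L = UNIV and G = "\<lambda>X. X"])
  have *: "scal_linear H (\<lambda>x. x)" by (simp add: scal_linear_def)
  then show "tlinear H (tmap H (\<lambda>x. x))" by (rule tlinear_tmap)
  show "tmap H (\<lambda>x. x) (pure H l) = pure H l" for l using * by (simp add: tmap_pure)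
qed (rule tlinear_id)

lemma tmap_tprod:
  assumes "scal_linear H \<tau>" "X \<in> all_tensors H" "Y \<in> all_tensors H"
  shows "tmap H \<tau> (tprod H X Y) = tprod H (tmap H \<tau> X) (tmap H \<tau> Y)"
  by (rule tbilinear_eqI[where L = UNIV and M = UNIV,
        OF tbilinear_comp_outer[OF tlinear_tmap tbilinear_tprod] tbilinear_comp_inner[OF tlinear_tmap tbilinear_tprod]])
    (use assms in \<open>auto simp: tprod_pure tmap_pure\<close>)

definition bialgebra_endo :: "('k::field, 'h::ring_1) hopf_data \<Rightarrow> ('h \<Rightarrow> 'h) \<Rightarrow> bool" where
  "bialgebra_endo H \<tau> \<longleftrightarrow> scal_linear H \<tau> \<and> \<tau> 1 = 1 \<and> (\<forall>x y. \<tau> (x * y) = \<tau> x * \<tau> y) \<and>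
     (\<forall>x. comult H (\<tau> x) = tmap H \<tau> (comult H x)) \<and> (\<forall>x. counit H (\<tau> x) = counit H x)"

context hopf_algebra
begin

lemma tmap_tmult:
  assumes "scal_linear H \<tau>" "\<And>x y. \<tau> (x * y) = \<tau> x * \<tau> y" "X \<in> all_tensors H" "Y \<in> all_tensors H"
  shows "tmap H \<tau> (tmult H X Y) = tmult H (tmap H \<tau> X) (tmap H \<tau> Y)"
proof (rule tbilinear_eqI[where L = UNIV and M = UNIV,
        OF tbilinear_comp_outer[OF tlinear_tmap tbilinear_tmult] tbilinear_comp_inner[OF tlinear_tmap tbilinear_tmult]])
  fix l m :: "'h list"
  have "map \<tau> (map2 (*) l m) = map2 (*) (map \<tau> l) (map \<tau> m)"
    using assms by (simp add: zip_map_map case_prod_beta)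
  then show "tmap H \<tau> (tmult H (pure H l) (pure H m)) = tmult H (tmap H \<tau> (pure H l)) (tmap H \<tau> (pure H m))"
    using assms by (simp add: tmult_pure tmap_pure tlinear_zero[OF tlinear_tmap])
qed (use assms in auto)

context
  fixes \<tau> assumes endo: "bialgebra_endo H \<tau>"
begin

lemma endo_simps:
  shows endo_linear: "scal_linear H \<tau>" and endo_one: "\<tau> 1 = 1" and endo_mult: "\<tau> (x * y) = \<tau> x * \<tau> y"
    and endo_comult: "comult H (\<tau> x) = tmap H \<tau> (comult H x)"
  using endo by (auto simp: bialgebra_endo_def)

lemmas endo_tlinear = tlinear_tmap[OF endo_linear]
lemmas endo_pure = tmap_pure[OF endo_linear]

lemma tmap_closed [simp]: "X \<in> all_tensors H \<Longrightarrow> tmap H \<tau> X \<in> all_tensors H"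
  using endo_tlinear by (rule tlinearD)

lemma tmap_comult_at: "tmap H \<tau> (comult_at H i l) = comult_at H i (map \<tau> l)"
  by (simp add: comult_at_def tmap_tprod endo_linear endo_pure endo_comult take_map drop_map
      tlinear_zero[OF endo_tlinear])

lemma tmap_sum:
  assumes "\<And>i. i \<in> A \<Longrightarrow> f i \<in> all_tensors H"
  shows "tmap H \<tau> (tzero H + (\<Sum>i\<in>A. f i)) = tzero H + (\<Sum>i\<in>A. tmap H \<tau> (f i))"
  using assms
proof (induction A rule: infinite_finite_induct)
  case (insert i A)
  have "tmap H \<tau> (f i + (tzero H + (\<Sum>i\<in>A. f i))) = tmap H \<tau> (f i) + tmap H \<tau> (tzero H + (\<Sum>i\<in>A. f i))"
    by (rule tlinearD[OF endo_tlinear]) (use insert in \<open>auto intro!: sum_tensor\<close>)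
  also have "\<dots> = tmap H \<tau> (f i) + (tzero H + (\<Sum>i\<in>A. tmap H \<tau> (f i)))"
    using insert by simp
  finally show ?case using insert.hyps by (simp add: ac_simps)
qed (simp_all add: tlinear_zero[OF endo_tlinear])

lemma tmap_D_op: "tmap H \<tau> (D_op H f) = D_op H (map \<tau> f)"
  unfolding D_op_def by (subst tmap_sum) (simp_all add: tlinearD[OF endo_tlinear] tmap_comult_at)

text \<open>
  On pure tensors the three parts of the differential are natural one by one: prepending the unit
  since \<open>\<tau> 1 = 1\<close>, the other two since \<open>\<tau>\<close> commutes with \<open>\<Delta>\<close>.  Lists have to be nonempty, as
  the empty list has no last entry that \<open>\<tau>\<close> could act on.
\<close>

lemma tmap_T_diff:
  assumes "X \<in> tensors H {l. l \<noteq> []}"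
  shows "T_diff H (tmap H \<tau> X) = tmap H \<tau> (T_diff H X)"
proof (rule tlinear_eqI[OF _ _ _ assms])
  fix l :: "'h list" assume "l \<in> {l. l \<noteq> []}"
  then obtain f c where l: "l = f @ [c]" by (cases l rule: rev_cases) auto
  have "tmap H \<tau> (diff_pure H f c) = diff_pure H (map \<tau> f) (\<tau> c)"
    by (simp add: diff_pure_def tlinearD[OF endo_tlinear] tmap_tprod endo_linear endo_pure endo_one
        endo_comult tmap_D_op)
  then show "T_diff H (tmap H \<tau> (pure H l)) = tmap H \<tau> (T_diff H (pure H l))"
    by (simp add: l endo_pure T_diff_pure)
qed (rule tlinear_comp[OF tlinear_T_diff endo_tlinear] tlinear_comp[OF endo_tlinear tlinear_T_diff])+

lemma tmap_iter_comult: "tmap H \<tau> (iter_comult H m c) = iter_comult H m (\<tau> c)"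
proof (induction m)
  case 0
  show ?case by (simp add: endo_pure)
next
  case (Suc m)
  note lin = tlinear_tlin[OF multilinear_comult_at[of 0]]
  have "tmap H \<tau> (tlin H (comult_at H 0) X) = tlin H (comult_at H 0) (tmap H \<tau> X)"
    if "X \<in> all_tensors H" for X
    by (rule tlinear_eqI[OF tlinear_comp[OF endo_tlinear lin] tlinear_comp[OF lin endo_tlinear] _ that])
      (simp add: endo_pure tlin_pure[OF multilinear_comult_at] tmap_comult_at)
  then show ?case by (simp add: Suc)
qed

text \<open>
  The product is juxtaposition with a factorwise product by an iterated coproduct, and each of
  these operations is natural.
\<close>

lemma tmap_odot:
  assumes "X \<in> tensors H {l. l \<noteq> []}" "Y \<in> tensors H {l. l \<noteq> []}"
  shows "tmap H \<tau> (odot H X Y) = odot H (tmap H \<tau> X) (tmap H \<tau> Y)"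
proof (rule tbilinear_eqI[OF tbilinear_comp_outer[OF endo_tlinear tbilinear_odot]
        tbilinear_comp_inner[OF endo_tlinear tbilinear_odot] _ assms])
  fix l m :: "'h list" assume "l \<in> {l. l \<noteq> []}" "m \<in> {l. l \<noteq> []}"
  then obtain f c g d where lm: "l = f @ [c]" "m = g @ [d]"
    by (cases l rule: rev_cases; cases m rule: rev_cases) auto
  have "tmap H \<tau> (odot_pure H f c g d) = odot_pure H (map \<tau> f) (\<tau> c) (map \<tau> g) (\<tau> d)"
    by (simp add: odot_pure_def tmap_tprod tmap_tmult endo_linear endo_mult endo_pure tmap_iter_comult)
  then show "tmap H \<tau> (odot H (pure H l) (pure H m)) = odot H (tmap H \<tau> (pure H l)) (tmap H \<tau> (pure H m))"
    by (simp add: lm endo_pure odot_pure_pure)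
qed

end

text \<open>
  Ensures that adding a coboundary to a cocycle stays within the tensors on which \<open>tmap_odot\<close>
  holds.
\<close>

lemma T_diff_nonempty: "X \<in> tensors H {l. l \<noteq> []} \<Longrightarrow> T_diff H X \<in> tensors H {l. l \<noteq> []}"
proof (rule tlinear_maps_tensors[OF tlinear_T_diff])
  fix l :: "'h list" assume "l \<in> {l. l \<noteq> []}"
  then obtain f c where l: "l = f @ [c]" by (cases l rule: rev_cases) auto
  have 1: "tprod H (D_op H f) (pure H [c]) \<in> tensors H {l. l \<noteq> []}"
    by (rule tprod_tensors[where L = UNIV and M = "{[c]}"]) auto
  have 2: "tprod H (pure H f) (comult H c) \<in> tensors H {l. l \<noteq> []}"
    by (rule tprod_tensors[where L = UNIV, OF _ comult_closed]) auto
  show "T_diff H (pure H l) \<in> tensors H {l. l \<noteq> []}"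
    unfolding l T_diff_pure diff_pure_def
    by (intro tensors_add tensors_scale 1 2) simp
qed

end

section \<open>Functoriality of the cohomology ring\<close>

text \<open>
  The class of every representative of \<open>\<xi>\<close> is collected, which avoids choosing one;
  \<open>induced_class\<close> shows that all these classes coincide.
\<close>

definition induced :: "('k::field, 'h::ring_1) hopf_data \<Rightarrow> 'h set \<Rightarrow> ('h \<Rightarrow> 'h)
    \<Rightarrow> ('k, 'h) tensor set \<Rightarrow> ('k, 'h) tensor set" where
  "induced H D \<tau> \<xi> = (\<Union>X\<in>\<xi>. cohomology_class H D (tmap H \<tau> X))"

lemma T_ring_simps:
  "carrier (T_ring H D) = tensors H {f @ [c] | f c. c \<in> D}"
  "monoid.mult (cocycle_ring H D) = odot H" "monoid.one (cocycle_ring H D) = pure H [1]"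
  "ring.add (cocycle_ring H D) = (+)" "carrier (cocycle_ring H D) = cocycles H D"
  by (simp_all add: T_ring_def cocycle_ring_def)

lemma cohomology_class_image: "cohomology_class H D X = (\<lambda>B. B + X) ` coboundaries H D"
  by (auto simp: cohomology_class_def a_r_coset_def' T_ring_simps)

lemma cohomology_carrier: "carrier (cohomology_ring H D) = cohomology_class H D ` cocycles H D"
  by (auto simp: cohomology_ring_def FactRing_def A_RCOSETS_def' T_ring_simps cohomology_class_def)

lemma T_ring_nonempty: "X \<in> carrier (T_ring H D) \<Longrightarrow> X \<in> tensors H {l. l \<noteq> []}"
  using tensors_mono[of "{f @ [c] | f c. c \<in> D}" "{l. l \<noteq> []}" H] by (auto simp: T_ring_simps)

lemma cocycles_T_ring: "X \<in> cocycles H D \<Longrightarrow> X \<in> carrier (T_ring H D)"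
  by (simp add: cocycles_def)

lemma cocycles_tensor: "X \<in> cocycles H D \<Longrightarrow> X \<in> all_tensors H"
  by (rule tensors_all[OF T_ring_nonempty[OF cocycles_T_ring]])

context hopf_algebra
begin

lemma coboundaries_nonempty: "B \<in> coboundaries H D \<Longrightarrow> B \<in> tensors H {l. l \<noteq> []}"
  by (auto simp: coboundaries_def intro: T_diff_nonempty T_ring_nonempty)

lemma coboundaries_tensor: "B \<in> coboundaries H D \<Longrightarrow> B \<in> all_tensors H"
  by (rule tensors_all[OF coboundaries_nonempty])

lemma coboundaries_closed:
  shows coboundaries_zero: "tzero H \<in> coboundaries H D"
    and coboundaries_add: "A \<in> coboundaries H D \<Longrightarrow> B \<in> coboundaries H D \<Longrightarrow> A + B \<in> coboundaries H D"
    and coboundaries_scale: "B \<in> coboundaries H D \<Longrightarrow> tscale H c B \<in> coboundaries H D"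
proof -
  let ?T = "tensors H {f @ [c] | f c. c \<in> D}"
  have "T_diff H (tzero H) \<in> T_diff H ` ?T" by (intro imageI) simp
  then show "tzero H \<in> coboundaries H D"
    by (simp add: coboundaries_def T_ring_simps tlinear_zero[OF tlinear_T_diff])
  show "A + B \<in> coboundaries H D" if "A \<in> coboundaries H D" "B \<in> coboundaries H D"
  proof -
    from that obtain X Y where XY: "X \<in> ?T" "Y \<in> ?T" "A = T_diff H X" "B = T_diff H Y"
      by (auto simp: coboundaries_def T_ring_simps)
    then have "A + B = T_diff H (X + Y)"
      using tlinearD(2)[OF tlinear_T_diff tensors_all tensors_all] by simp
    with XY show ?thesis by (simp add: coboundaries_def T_ring_simps)
  qed
  show "tscale H c B \<in> coboundaries H D" if "B \<in> coboundaries H D"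
  proof -
    from that obtain X where X: "X \<in> ?T" "B = T_diff H X"
      by (auto simp: coboundaries_def T_ring_simps)
    then have "tscale H c B = T_diff H (tscale H c X)"
      using tlinearD(3)[OF tlinear_T_diff tensors_all] by simp
    with X show ?thesis by (simp add: coboundaries_def T_ring_simps)
  qed
qed

text \<open>
  Addition of sets has no inverses; \<open>tscale H (-1) B\<close> takes the place of the negative of \<open>B\<close>.
\<close>

lemma class_absorb:
  assumes "B \<in> coboundaries H D" "X \<in> all_tensors H"
  shows "cohomology_class H D (B + X) = cohomology_class H D X"
proof
  show "cohomology_class H D (B + X) \<subseteq> cohomology_class H D X"
    using coboundaries_add[OF _ assms(1)] by (auto simp: cohomology_class_image simp flip: add.assoc)
  show "cohomology_class H D X \<subseteq> cohomology_class H D (B + X)"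
  proof
    fix Y assume "Y \<in> cohomology_class H D X"
    then obtain A where A: "A \<in> coboundaries H D" "Y = A + X" by (auto simp: cohomology_class_image)
    have "Y = (A + (tscale H (-1) B + B)) + X"
      using A assms by (simp add: tscale_neg coboundaries_tensor)
    then have "Y = (A + tscale H (-1) B) + (B + X)" by (simp add: ac_simps)
    then show "Y \<in> cohomology_class H D (B + X)"
      unfolding cohomology_class_image using A(1) assms(1)
      by (auto intro!: image_eqI coboundaries_add coboundaries_scale)
  qed
qed

lemma class_add:
  assumes "X \<in> all_tensors H" "Y \<in> all_tensors H"
  shows "cohomology_class H D X \<oplus>\<^bsub>cohomology_ring H D\<^esub> cohomology_class H D Y
    = cohomology_class H D (X + Y)"
proof -
  have *: "cohomology_class H D X \<oplus>\<^bsub>cohomology_ring H D\<^esub> cohomology_class H D Y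
      = {A + X + (B + Y) | A B. A \<in> coboundaries H D \<and> B \<in> coboundaries H D}"
    by (auto simp: cohomology_ring_def FactRing_def set_add_def' T_ring_simps cohomology_class_image)
  show ?thesis
    unfolding *
  proof (intro subset_antisym subsetI)
    fix Z assume "Z \<in> {A + X + (B + Y) | A B. A \<in> coboundaries H D \<and> B \<in> coboundaries H D}"
    then obtain A B where AB: "A \<in> coboundaries H D" "B \<in> coboundaries H D" "Z = A + X + (B + Y)"
      by blast
    then have "Z = (A + B) + (X + Y)" by (simp add: ac_simps)
    with AB show "Z \<in> cohomology_class H D (X + Y)"
      by (auto simp: cohomology_class_image coboundaries_add)
  next
    fix Z assume "Z \<in> cohomology_class H D (X + Y)"
    then obtain A where "A \<in> coboundaries H D" "Z = A + (X + Y)" by (auto simp: cohomology_class_image)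
    moreover from this have "Z = A + X + (tzero H + Y)" using assms by (simp add: ac_simps)
    ultimately show "Z \<in> {A + X + (B + Y) | A B. A \<in> coboundaries H D \<and> B \<in> coboundaries H D}"
      using coboundaries_zero by blast
  qed
qed

lemma class_mult:
  "\<xi> \<otimes>\<^bsub>cohomology_ring H D\<^esub> \<eta> = (\<Union>X\<in>\<xi>. \<Union>Y\<in>\<eta>. cohomology_class H D (odot H X Y))"
  by (simp add: cohomology_ring_def FactRing_def rcoset_mult_def T_ring_simps cohomology_class_def)

lemma class_one: "\<one>\<^bsub>cohomology_ring H D\<^esub> = cohomology_class H D (pure H [1])"
  by (simp add: cohomology_ring_def FactRing_def T_ring_simps cohomology_class_def)

lemma class_scale:
  assumes "X \<in> all_tensors H"
  shows "cohomology_scale H D c (cohomology_class H D X) = cohomology_class H D (tscale H c X)"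
proof -
  have "cohomology_class H D (tscale H c (B + X)) = cohomology_class H D (tscale H c X)"
    if "B \<in> coboundaries H D" for B
    using that assms by (simp add: tscale_add coboundaries_tensor class_absorb coboundaries_scale)
  then show ?thesis
    using coboundaries_zero[of D] unfolding cohomology_scale_def cohomology_class_image[of H D X] by auto
qed

lemma class_nonempty:
  "X \<in> tensors H {l. l \<noteq> []} \<Longrightarrow> Y \<in> cohomology_class H D X \<Longrightarrow> Y \<in> tensors H {l. l \<noteq> []}"
  by (auto simp: cohomology_class_image coboundaries_nonempty)

context
  fixes \<tau> D
  assumes endo: "bialgebra_endo H \<tau>" and pres: "\<tau> ` D \<subseteq> D"
begin

lemma tmap_T_degree: "X \<in> T_degree H D n \<Longrightarrow> tmap H \<tau> X \<in> T_degree H D n"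
  unfolding T_degree_def by (rule tmap_tensors[OF endo_linear[OF endo]]) (use pres in auto)

lemma tmap_T_ring: "X \<in> carrier (T_ring H D) \<Longrightarrow> tmap H \<tau> X \<in> carrier (T_ring H D)"
  unfolding T_ring_simps by (rule tmap_tensors[OF endo_linear[OF endo]]) (use pres in auto)

lemma tmap_T_diff_T_ring:
  "X \<in> carrier (T_ring H D) \<Longrightarrow> T_diff H (tmap H \<tau> X) = tmap H \<tau> (T_diff H X)"
  by (rule tmap_T_diff[OF endo T_ring_nonempty])

lemma tmap_cocycles: "X \<in> cocycles H D \<Longrightarrow> tmap H \<tau> X \<in> cocycles H D"
  by (simp add: cocycles_def tmap_T_ring tmap_T_diff_T_ring tlinear_zero[OF endo_tlinear[OF endo]])

lemma tmap_coboundaries: "X \<in> coboundaries H D \<Longrightarrow> tmap H \<tau> X \<in> coboundaries H D"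
  by (auto simp: coboundaries_def tmap_T_ring simp flip: tmap_T_diff_T_ring)

text \<open>
  Applying \<open>\<tau>\<close> to \<open>B + X\<close>, with \<open>B\<close> a coboundary, gives a coboundary plus the image of \<open>X\<close>, so the union
  that defines the induced map has only one member.
\<close>

lemma induced_class:
  assumes "X \<in> all_tensors H"
  shows "induced H D \<tau> (cohomology_class H D X) = cohomology_class H D (tmap H \<tau> X)"
proof -
  have "cohomology_class H D (tmap H \<tau> (B + X)) = cohomology_class H D (tmap H \<tau> X)"
    if "B \<in> coboundaries H D" for B
    using that assms
    by (simp add: tlinearD(2)[OF endo_tlinear[OF endo]] coboundaries_tensor class_absorb
        tmap_coboundaries tmap_closed[OF endo])
  then show ?thesis
    using coboundaries_zero[of D] unfolding induced_def cohomology_class_image[of H D X] by auto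
qed

lemma induced_carrier: "\<xi> \<in> carrier (cohomology_ring H D) \<Longrightarrow> induced H D \<tau> \<xi> \<in> carrier (cohomology_ring H D)"
  by (auto simp: cohomology_carrier induced_class cocycles_tensor tmap_cocycles)

end

lemma induced_comp:
  assumes "bialgebra_endo H \<tau>" "\<tau> ` D \<subseteq> D" "bialgebra_endo H \<sigma>" "\<sigma> ` D \<subseteq> D"
    "bialgebra_endo H (\<lambda>x. \<tau> (\<sigma> x))" "\<xi> \<in> carrier (cohomology_ring H D)"
  shows "induced H D \<tau> (induced H D \<sigma> \<xi>) = induced H D (\<lambda>x. \<tau> (\<sigma> x)) \<xi>"
proof -
  from assms(6) obtain X where X: "X \<in> all_tensors H" "\<xi> = cohomology_class H D X"
    using cocycles_tensor by (auto simp: cohomology_carrier)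
  have "(\<lambda>x. \<tau> (\<sigma> x)) ` D \<subseteq> D" using assms by blast
  then show ?thesis
    using X assms by (simp add: induced_class tmap_closed tmap_comp endo_linear)
qed

lemma induced_ident:
  assumes "\<xi> \<in> carrier (cohomology_ring H D)"
  shows "induced H D (\<lambda>x. x) \<xi> = \<xi>"
proof -
  from assms obtain X where X: "X \<in> all_tensors H" "\<xi> = cohomology_class H D X"
    using cocycles_tensor by (auto simp: cohomology_carrier)
  have "bialgebra_endo H (\<lambda>x. x)"
    by (simp add: bialgebra_endo_def scal_linear_def tmap_ident)
  with X show ?thesis by (simp add: induced_class tmap_ident)
qed

context
  fixes \<tau> \<sigma> D
  assumes endo: "bialgebra_endo H \<tau>" "bialgebra_endo H \<sigma>"
    and pres: "\<tau> ` D \<subseteq> D" "\<sigma> ` D \<subseteq> D"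
    and inverse: "\<And>x. \<tau> (\<sigma> x) = x" "\<And>x. \<sigma> (\<tau> x) = x"
begin

lemma tmap_inverse:
  assumes "X \<in> all_tensors H"
  shows "tmap H \<tau> (tmap H \<sigma> X) = X" "tmap H \<sigma> (tmap H \<tau> X) = X"
  using assms endo by (simp_all add: tmap_comp endo_linear inverse tmap_ident)

lemma induced_bij: "bij_betw (induced H D \<tau>) (carrier (cohomology_ring H D)) (carrier (cohomology_ring H D))"
proof (rule bij_betwI)
  have ident: "bialgebra_endo H (\<lambda>x. x)"
    by (simp add: bialgebra_endo_def scal_linear_def tmap_ident)
  show "induced H D \<tau> \<in> carrier (cohomology_ring H D) \<rightarrow> carrier (cohomology_ring H D)"
    "induced H D \<sigma> \<in> carrier (cohomology_ring H D) \<rightarrow> carrier (cohomology_ring H D)"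
    using induced_carrier endo pres by auto
  show "induced H D \<sigma> (induced H D \<tau> \<xi>) = \<xi>" if "\<xi> \<in> carrier (cohomology_ring H D)" for \<xi>
    using induced_comp[of \<sigma> D \<tau>] endo pres that ident by (simp add: inverse induced_ident)
  show "induced H D \<tau> (induced H D \<sigma> \<xi>) = \<xi>" if "\<xi> \<in> carrier (cohomology_ring H D)" for \<xi>
    using induced_comp[of \<tau> D \<sigma>] endo pres that ident by (simp add: inverse induced_ident)
qed

text \<open>
  Since \<open>\<sigma>\<close> provides preimages, \<open>\<tau>\<close> maps the coboundaries onto themselves.
\<close>

lemma tmap_class_image:
  assumes "X \<in> all_tensors H"
  shows "tmap H \<tau> ` cohomology_class H D X = cohomology_class H D (tmap H \<tau> X)"
proof -
  have "tmap H \<tau> ` coboundaries H D = coboundaries H D"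
  proof (intro subset_antisym subsetI)
    fix B assume "B \<in> coboundaries H D"
    then have "B = tmap H \<tau> (tmap H \<sigma> B)" "tmap H \<sigma> B \<in> coboundaries H D"
      using tmap_coboundaries[OF endo(2) pres(2)] by (simp_all add: tmap_inverse coboundaries_tensor)
    then show "B \<in> tmap H \<tau> ` coboundaries H D" by blast
  qed (use tmap_coboundaries[OF endo(1) pres(1)] in blast)
  moreover have "tmap H \<tau> ` cohomology_class H D X = (\<lambda>B. B + tmap H \<tau> X) ` tmap H \<tau> ` coboundaries H D"
    unfolding cohomology_class_image image_image
    by (rule image_cong) (simp_all add: tlinearD(2)[OF endo_tlinear[OF endo(1)]] coboundaries_tensor assms)
  ultimately show ?thesis by (simp add: cohomology_class_image)
qed

text \<open>
  Both sides are unions of the classes of \<open>(\<tau> A) \<odot> (\<tau> B)\<close>, with \<open>A\<close> and \<open>B\<close> running through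
  the representatives of the two classes; by \<open>tmap_class_image\<close> the images \<open>\<tau> A\<close>, \<open>\<tau> B\<close> run
  through all representatives of the image classes.
\<close>

lemma induced_mult:
  assumes X: "X \<in> tensors H {l. l \<noteq> []}" and Y: "Y \<in> tensors H {l. l \<noteq> []}"
  shows "induced H D \<tau> (cohomology_class H D X \<otimes>\<^bsub>cohomology_ring H D\<^esub> cohomology_class H D Y)
    = cohomology_class H D (tmap H \<tau> X) \<otimes>\<^bsub>cohomology_ring H D\<^esub> cohomology_class H D (tmap H \<tau> Y)"
proof -
  let ?c = "cohomology_class H D"
  have "induced H D \<tau> (?c X \<otimes>\<^bsub>cohomology_ring H D\<^esub> ?c Y)
      = (\<Union>A\<in>?c X. \<Union>B\<in>?c Y. induced H D \<tau> (?c (odot H A B)))"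
    unfolding class_mult induced_def by blast
  also have "\<dots> = (\<Union>A\<in>?c X. \<Union>B\<in>?c Y. ?c (odot H (tmap H \<tau> A) (tmap H \<tau> B)))"
  proof (intro SUP_cong refl)
    fix A B assume "A \<in> ?c X" "B \<in> ?c Y"
    then have AB: "A \<in> tensors H {l. l \<noteq> []}" "B \<in> tensors H {l. l \<noteq> []}"
      using class_nonempty X Y by blast+
    then have "odot H A B \<in> all_tensors H" by (intro odot_closed tensors_all)
    with AB show "induced H D \<tau> (?c (odot H A B)) = ?c (odot H (tmap H \<tau> A) (tmap H \<tau> B))"
      by (simp add: induced_class[OF endo(1) pres(1)] tmap_odot[OF endo(1)])
  qed
  also have "\<dots> = (\<Union>A\<in>tmap H \<tau> ` ?c X. \<Union>B\<in>tmap H \<tau> ` ?c Y. ?c (odot H A B))"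
    by (simp add: image_image)
  also have "\<dots> = ?c (tmap H \<tau> X) \<otimes>\<^bsub>cohomology_ring H D\<^esub> ?c (tmap H \<tau> Y)"
    using tensors_all[OF X] tensors_all[OF Y] by (simp only: tmap_class_image class_mult)
  finally show ?thesis .
qed

theorem induced_automorphism: "graded_algebra_automorphism H D (induced H D \<tau>)"
  unfolding graded_algebra_automorphism_def
proof (intro conjI allI ballI)
  note ind = induced_class[OF endo(1) pres(1)]
  show "induced H D \<tau> \<in> ring_iso (cohomology_ring H D) (cohomology_ring H D)"
    unfolding ring_iso_def
  proof (intro CollectI conjI induced_bij ring_hom_memI)
    fix \<xi> \<eta> assume "\<xi> \<in> carrier (cohomology_ring H D)" "\<eta> \<in> carrier (cohomology_ring H D)"
    then obtain X Y where XY: "X \<in> cocycles H D" "Y \<in> cocycles H D"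
        "\<xi> = cohomology_class H D X" "\<eta> = cohomology_class H D Y"
      by (auto simp: cohomology_carrier)
    note T = T_ring_nonempty[OF cocycles_T_ring[OF XY(1)]] T_ring_nonempty[OF cocycles_T_ring[OF XY(2)]]
    show "induced H D \<tau> \<xi> \<in> carrier (cohomology_ring H D)"
      using \<open>\<xi> \<in> _\<close> by (rule induced_carrier[OF endo(1) pres(1)])
    show "induced H D \<tau> (\<xi> \<otimes>\<^bsub>cohomology_ring H D\<^esub> \<eta>)
        = induced H D \<tau> \<xi> \<otimes>\<^bsub>cohomology_ring H D\<^esub> induced H D \<tau> \<eta>"
      using induced_mult[OF T] XY by (simp add: ind cocycles_tensor)
    show "induced H D \<tau> (\<xi> \<oplus>\<^bsub>cohomology_ring H D\<^esub> \<eta>)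
        = induced H D \<tau> \<xi> \<oplus>\<^bsub>cohomology_ring H D\<^esub> induced H D \<tau> \<eta>"
      using XY by (simp add: class_add ind cocycles_tensor tmap_closed[OF endo(1)]
          tlinearD(2)[OF endo_tlinear[OF endo(1)]])
  next
    show "induced H D \<tau> \<one>\<^bsub>cohomology_ring H D\<^esub> = \<one>\<^bsub>cohomology_ring H D\<^esub>"
      by (simp add: class_one ind endo_pure[OF endo(1)] endo_one[OF endo(1)])
  qed
  show "induced H D \<tau> (cohomology_scale H D c \<xi>) = cohomology_scale H D c (induced H D \<tau> \<xi>)"
    if "\<xi> \<in> carrier (cohomology_ring H D)" for c \<xi>
    using that by (auto simp: cohomology_carrier class_scale ind cocycles_tensor tmap_closed[OF endo(1)]
        tlinearD(3)[OF endo_tlinear[OF endo(1)]])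
  show "induced H D \<tau> ` cohomology_degree H D n = cohomology_degree H D n" for n
  proof -
    let ?Z = "cocycles H D \<inter> T_degree H D n"
    have "tmap H \<tau> ` ?Z = ?Z"
    proof (intro subset_antisym subsetI)
      fix X assume X: "X \<in> ?Z"
      then have "X \<in> all_tensors H" using cocycles_tensor by blast
      with X have "X = tmap H \<tau> (tmap H \<sigma> X)" "tmap H \<sigma> X \<in> ?Z"
        using tmap_cocycles[OF endo(2) pres(2)] tmap_T_degree[OF endo(2) pres(2)]
        by (simp_all add: tmap_inverse)
      then show "X \<in> tmap H \<tau> ` ?Z" by blast
    qed (use tmap_cocycles[OF endo(1) pres(1)] tmap_T_degree[OF endo(1) pres(1)] in blast)
    moreover have "induced H D \<tau> ` cohomology_degree H D n = cohomology_class H D ` tmap H \<tau> ` ?Z"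
      unfolding cohomology_degree_def image_image
      by (rule image_cong) (auto intro!: ind cocycles_tensor)
    ultimately show ?thesis by (simp add: cohomology_degree_def)
  qed
qed

end

section \<open>The group of grouplike elements\<close>

text \<open>
  The counit and antipode axioms prescribe a map on the second tensor power by a case
  distinction on lists; this makes them applicable to the pure tensor \<open>[a, a]\<close>.
\<close>

lemma multilinear_case2:
  assumes "\<And>v. hlinear H (\<lambda>u. \<beta> u v)" "\<And>u. hlinear H (\<beta> u)"
  shows "multilinear H (\<lambda>l. case l of [u, v] \<Rightarrow> \<beta> u v | _ \<Rightarrow> tzero H)"
proof (rule multilinearI)
  fix xs ys :: "'h list"
  consider v where "xs = []" "ys = [v]" | w where "xs = [w]" "ys = []"
    | "length xs + length ys \<noteq> 1"
    by (cases xs; cases ys) auto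
  then show "hlinear H (\<lambda>u. case xs @ [u] @ ys of [u, v] \<Rightarrow> \<beta> u v | _ \<Rightarrow> tzero H)"
  proof cases
    case 3
    then have "(\<lambda>u. case xs @ [u] @ ys of [u, v] \<Rightarrow> \<beta> u v | _ \<Rightarrow> tzero H) = (\<lambda>u. tzero H)"
      by (cases xs; cases ys; cases "tl xs"; cases "tl ys") (auto split: list.split simp: fun_eq_iff)
    then show ?thesis by (simp only: hlinear_tzero)
  qed (use assms in simp_all)
qed simp

text \<open>
  The linear map that sends a list \<open>[h]\<close> to \<open>h\<close> and all other lists to 0 kills the relators, so
  it recovers an element of \<open>H\<close> from its tensor.
\<close>

lemma pure_single_inject:
  assumes "pure H [x] = pure H [y]"
  shows "x = y"
proof -
  let ?E = "lin_ext (scal H) (\<lambda>l. case l of [h] \<Rightarrow> h | _ \<Rightarrow> 0)"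
  have relator: "?E r = 0" if "r \<in> multilinear_relators H" for r
  proof -
    have *: "(case xs @ [u] @ ys of [h] \<Rightarrow> h | _ \<Rightarrow> 0) = (if xs = [] \<and> ys = [] then u else 0)"
      for xs ys and u :: 'h
      by (cases xs; cases ys) (auto split: list.split)
    from that show ?thesis
      unfolding multilinear_relators_def
      by (auto simp only: Un_iff mem_Collect_eq lin_ext_diff lin_ext_scale lin_ext_gen *) auto
  qed
  have "gen [x] - gen [y] \<in> tzero H"
    using assms by (simp add: pure_tclass tclass_eq_iff)
  then have "?E (gen [x] - gen [y]) = 0"
    unfolding tzero_def
    by (induction rule: free.span_induct_alt) (simp_all add: lin_ext_zero lin_ext_add lin_ext_scale relator)
  then show ?thesis by (simp add: lin_ext_diff lin_ext_gen)
qed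

lemma hlinear_scale_counit: "X \<in> all_tensors H \<Longrightarrow> hlinear H (\<lambda>u. tscale H (counit H u) X)"
  by (auto elim!: all_tensorsE simp: hlinear_def counit_add counit_scal tscale_tclass tclass_add
      free.scale_left_distrib)

text \<open>
  The counit axiom for a grouplike \<open>a\<close> reads \<open>\<epsilon>(a)a = a\<close>, and \<open>a \<noteq> 0\<close>.
\<close>

lemma grouplike_counit:
  assumes "a \<in> grouplikes H"
  shows "counit H a = 1"
proof -
  have "multilinear H (\<lambda>l. case l of [u, v] \<Rightarrow> tscale H (counit H u) (pure H [v]) | _ \<Rightarrow> tzero H)"
    by (intro multilinear_case2 hlinear_scale_counit hlinear_comp[OF tlinear_scale hlinear_pure1]) simp
  from tlin_pure[OF this, of "[a, a]"] have "tscale H (counit H a) (pure H [a]) = pure H [a]"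
    using assms counit_left[of a] by (simp add: grouplikes_def)
  then have "pure H [scal H (counit H a) a] = pure H [a]"
    using hlinearD(3)[OF hlinear_pure1] by simp
  then have "scal H (counit H a) a = scal H 1 a" by (simp add: pure_single_inject)
  then show ?thesis
    using assms scale_cancel_right[of "counit H a" a 1] by (simp add: grouplikes_def)
qed

lemma grouplike_one: "1 \<in> grouplikes H"
  by (simp add: grouplikes_def comult_one)

text \<open>
  Grouplikes have counit 1, so this keeps products of them away from 0 although \<open>H\<close> may have
  zero divisors.
\<close>

lemma counit_nonzero: "counit H x \<noteq> 0 \<Longrightarrow> x \<noteq> 0"
  using counit_scal[of 0 0] by auto

lemma grouplike_mult:
  assumes "a \<in> grouplikes H" "b \<in> grouplikes H"
  shows "a * b \<in> grouplikes H"
proof -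
  have "a * b \<noteq> 0"
    using assms by (intro counit_nonzero) (simp add: counit_mult grouplike_counit)
  moreover have "comult H (a * b) = pure H [a * b, a * b]"
    using assms by (simp add: comult_mult grouplikes_def tmult_pure)
  ultimately show ?thesis by (simp add: grouplikes_def)
qed

lemma hlinear_pure_mult:
  "hlinear H f \<Longrightarrow> hlinear H (\<lambda>u. f (u * v))" "hlinear H f \<Longrightarrow> hlinear H (\<lambda>u. f (v * u))"
  by (auto intro!: hlinear_precomp simp: distrib_left distrib_right
      simp flip: scal_mult_left scal_mult_right)

lemma grouplike_antipode_mult:
  assumes "a \<in> grouplikes H"
  shows "antipode H a * a = 1" and "a * antipode H a = 1"
proof -
  have l: "multilinear H (\<lambda>l. case l of [u, v] \<Rightarrow> pure H [antipode H u * v] | _ \<Rightarrow> tzero H)"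
    by (intro multilinear_case2 hlinear_pure_mult hlinear_pure1
        hlinear_precomp[of H "\<lambda>u. pure H [u * _]"] antipode_add antipode_scal)
  have r: "multilinear H (\<lambda>l. case l of [u, v] \<Rightarrow> pure H [u * antipode H v] | _ \<Rightarrow> tzero H)"
    by (intro multilinear_case2 hlinear_pure_mult hlinear_pure1
        hlinear_precomp[of H "\<lambda>u. pure H [_ * u]"] antipode_add antipode_scal)
  have "pure H [antipode H a * a] = pure H [1]"
    using tlin_pure[OF l, of "[a, a]"] antipode_left[of a] assms grouplike_counit[OF assms]
    by (simp add: grouplikes_def)
  then show "antipode H a * a = 1" by (rule pure_single_inject)
  have "pure H [a * antipode H a] = pure H [1]"
    using tlin_pure[OF r, of "[a, a]"] antipode_right[of a] assms grouplike_counit[OF assms]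
    by (simp add: grouplikes_def)
  then show "a * antipode H a = 1" by (rule pure_single_inject)
qed

text \<open>
  Since \<open>\<Delta>(S(a))(a \<otimes> a) = \<Delta>(S(a)a) = 1 \<otimes> 1\<close>, multiplying by \<open>S(a) \<otimes> S(a)\<close> on the right
  gives \<open>\<Delta>(S(a)) = S(a) \<otimes> S(a)\<close>.
\<close>

lemma grouplike_antipode:
  assumes a: "a \<in> grouplikes H"
  shows "antipode H a \<in> grouplikes H"
proof -
  let ?b = "antipode H a" and ?R = "\<lambda>m X. tmult H X (pure H m)"
  have "?R [?b, ?b] (?R [a, a] (comult H ?b)) = comult H ?b"
    by (rule tlinear_eqI[OF tlinear_comp[OF tmult_left tmult_left] tlinear_id _ comult_closed])
      (auto simp: tmult_pure length_Suc_conv numeral_2_eq_2 mult.assoc grouplike_antipode_mult[OF a])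
  moreover have "?R [a, a] (comult H ?b) = pure H [1, 1]"
    using comult_mult[of ?b a] a by (simp add: grouplikes_def grouplike_antipode_mult comult_one)
  ultimately have "comult H ?b = pure H [?b, ?b]" by (simp add: tmult_pure)
  moreover have "?b \<noteq> 0" using grouplike_antipode_mult[OF a] by auto
  ultimately show ?thesis by (simp add: grouplikes_def)
qed

lemma grouplike_group_simps:
  "carrier (grouplike_group H) = grouplikes H" "x \<otimes>\<^bsub>grouplike_group H\<^esub> y = x * y"
  "\<one>\<^bsub>grouplike_group H\<^esub> = 1"
  by (simp_all add: grouplike_group_def)

lemma group_grouplikes: "group (grouplike_group H)"
  by (rule groupI)
    (auto simp: grouplike_group_simps grouplike_mult grouplike_one mult.assoc
      intro: grouplike_antipode grouplike_antipode_mult)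

lemma grouplike_inv: "a \<in> grouplikes H \<Longrightarrow> inv\<^bsub>grouplike_group H\<^esub> a = antipode H a"
  by (rule group.inv_equality[OF group_grouplikes])
    (simp_all add: grouplike_group_simps grouplike_antipode grouplike_antipode_mult)

section \<open>Conjugation\<close>

text \<open>
  Multiplying by \<open>a \<otimes> a\<close> on the left and by \<open>b \<otimes> b\<close> on the right is conjugation on each
  tensor factor; with \<open>a\<close> and \<open>b\<close> grouplike this is the coproduct of a conjugate.
\<close>

lemma conj_endo:
  assumes "a \<in> grouplikes H" "b \<in> grouplikes H" "a * b = 1" "b * a = 1"
  shows "bialgebra_endo H (\<lambda>x. a * x * b)"
proof -
  have lin: "scal_linear H (\<lambda>x. a * x * b)"
    by (simp add: scal_linear_def distrib_left distrib_right flip: scal_mult_left scal_mult_right)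
  have "tmult H (tmult H (pure H [a, a]) X) (pure H [b, b]) = tmap H (\<lambda>x. a * x * b) X"
    if "X \<in> tensors H {l. length l = 2}" for X
    by (rule tlinear_eqI[OF tlinear_comp[OF tmult_left tmult_right] tlinear_tmap[OF lin] _ that])
      (auto simp: tmult_pure tmap_pure[OF lin] length_Suc_conv numeral_2_eq_2)
  then have "comult H (a * x * b) = tmap H (\<lambda>x. a * x * b) (comult H x)" for x
    using assms comult_closed by (simp add: comult_mult grouplikes_def)
  moreover have "a * (x * y) * b = a * x * b * (a * y * b)" for x y
  proof -
    have "a * x * b * (a * y * b) = a * x * (b * a) * y * b" by (simp only: mult.assoc)
    then show ?thesis using assms by (simp add: mult.assoc)
  qed
  moreover have "counit H (a * x * b) = counit H x" for x
    using assms by (simp add: counit_mult grouplike_counit)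
  ultimately show ?thesis using lin assms by (simp add: bialgebra_endo_def)
qed

lemma conj_grouplike_algebra:
  assumes "a \<in> grouplikes H" "b \<in> grouplikes H"
  shows "(\<lambda>x. a * x * b) ` grouplike_algebra H \<subseteq> grouplike_algebra H"
proof clarify
  fix x assume "x \<in> grouplike_algebra H"
  then show "a * x * b \<in> grouplike_algebra H"
    unfolding grouplike_algebra_def
  proof (induction rule: span_induct_alt)
    case base
    then show ?case by (simp add: span_zero)
  next
    case (step c x y)
    have "a * x * b \<in> span (grouplikes H)"
      using step assms by (intro span_base grouplike_mult)
    moreover have "a * (scal H c x + y) * b = scal H c (a * x * b) + a * y * b"
      by (simp add: distrib_left distrib_right flip: scal_mult_left scal_mult_right)
    ultimately show ?case using step by (simp add: span_add span_scale)
  qed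
qed

lemma conj_ground_algebra:
  assumes "a * b = 1"
  shows "(\<lambda>x. a * x * b) ` ground_algebra H \<subseteq> ground_algebra H"
  using assms by (auto simp: ground_algebra_def simp flip: scal_mult_left scal_mult_right)

abbreviation conj_by :: "'h \<Rightarrow> 'h \<Rightarrow> 'h" where
  "conj_by a \<equiv> \<lambda>x. a * x * inv\<^bsub>grouplike_group H\<^esub> a"

lemma conj_by_endo: "a \<in> grouplikes H \<Longrightarrow> bialgebra_endo H (conj_by a)"
  by (simp add: grouplike_inv conj_endo grouplike_antipode grouplike_antipode_mult)

lemma conj_by_mult:
  assumes "a \<in> grouplikes H" "b \<in> grouplikes H"
  shows "conj_by (a * b) x = conj_by a (conj_by b x)"
proof -
  have "inv\<^bsub>grouplike_group H\<^esub> (a * b) = inv\<^bsub>grouplike_group H\<^esub> b * inv\<^bsub>grouplike_group H\<^esub> a"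
    using group.inv_mult_group[OF group_grouplikes, of a b] assms by (simp add: grouplike_group_simps)
  then show ?thesis by (simp add: mult.assoc)
qed

lemma conj_by_inverse:
  assumes "a \<in> grouplikes H"
  shows "conj_by a (conj_by (antipode H a) x) = x" "conj_by (antipode H a) (conj_by a x) = x"
proof -
  have "conj_by 1 x = x"
    using monoid.inv_one[OF group.is_monoid[OF group_grouplikes]] by (simp add: grouplike_group_simps)
  then show "conj_by a (conj_by (antipode H a) x) = x" "conj_by (antipode H a) (conj_by a x) = x"
    using assms conj_by_mult[of a "antipode H a" x] conj_by_mult[of "antipode H a" a x]
    by (simp_all add: grouplike_antipode grouplike_antipode_mult)
qed

lemma conj_cohomology_induced: "conj_cohomology H D a = induced H D (conj_by a)"
  by (rule ext) (simp add: conj_cohomology_def induced_def conj_tensor_def tmap_def)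

lemma conj_tensor_tmap: "conj_tensor H a = tmap H (conj_by a)"
  by (simp add: conj_tensor_def tmap_def)

context
  fixes D assumes stable: "\<And>a. a \<in> grouplikes H \<Longrightarrow> conj_by a ` D \<subseteq> D"
begin

lemma conj_automorphism:
  "a \<in> grouplikes H \<Longrightarrow> graded_algebra_automorphism H D (conj_cohomology H D a)"
  unfolding conj_cohomology_induced
  by (rule induced_automorphism[where \<sigma> = "conj_by (antipode H a)"])
    (simp_all only: conj_by_endo grouplike_antipode stable conj_by_inverse)

lemma conj_group_action:
  "group_action (grouplike_group H) (carrier (cohomology_ring H D))
    (\<lambda>a. restrict (conj_cohomology H D a) (carrier (cohomology_ring H D)))"
proof -
  let ?E = "carrier (cohomology_ring H D)"
  have bij: "bij_betw (conj_cohomology H D a) ?E ?E" if "a \<in> grouplikes H" for a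
    using conj_automorphism[OF that] by (simp add: graded_algebra_automorphism_def ring_iso_def)
  have Bij: "restrict (conj_cohomology H D a) ?E \<in> Bij ?E" if "a \<in> grouplikes H" for a
    using bij[OF that] by (simp add: Bij_def bij_betw_restrict_eq)
  have mult: "restrict (conj_cohomology H D (a * b)) ?E
      = compose ?E (restrict (conj_cohomology H D a) ?E) (restrict (conj_cohomology H D b) ?E)"
    if "a \<in> grouplikes H" "b \<in> grouplikes H" for a b
  proof
    fix \<xi>
    have conj: "conj_by (a * b) = (\<lambda>x. conj_by a (conj_by b x))"
      using conj_by_mult[OF that] by (rule ext)
    show "restrict (conj_cohomology H D (a * b)) ?E \<xi>
        = compose ?E (restrict (conj_cohomology H D a) ?E) (restrict (conj_cohomology H D b) ?E) \<xi>"
    proof (cases "\<xi> \<in> ?E")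
      case True
      then have "conj_cohomology H D b \<xi> \<in> ?E" using bij[OF that(2)] by (auto simp: bij_betw_def)
      moreover have "induced H D (conj_by a) (induced H D (conj_by b) \<xi>) = induced H D (conj_by (a * b)) \<xi>"
        unfolding conj
        by (rule induced_comp)
          (use that True conj_by_endo[OF grouplike_mult[OF that]] in \<open>simp_all only: conj_by_endo stable conj\<close>)
      ultimately show ?thesis using True by (simp only: compose_eq restrict_apply' conj_cohomology_induced)
    qed (simp add: compose_def)
  qed
  have "(\<lambda>a. restrict (conj_cohomology H D a) ?E) \<in> hom (grouplike_group H) (BijGroup ?E)"
    by (rule homI) (simp_all add: grouplike_group_simps BijGroup_def Bij mult)
  then show ?thesis
    unfolding group_action_def group_hom_def group_hom_axioms_def
    by (simp add: group_grouplikes group_BijGroup)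
qed

end

end

theorem theorem0p3:
  fixes H :: "('k::{alg_closed_field, field_char_0}, 'h::ring_1) hopf_data"
  assumes "hopf_algebra H"
  shows "\<forall>D \<in> {grouplike_algebra H, ground_algebra H}.
    (\<forall>a\<in>carrier (grouplike_group H).
       (\<forall>n. \<forall>X\<in>T_degree H D n. conj_tensor H a X \<in> T_degree H D n) \<and>
       (\<forall>X\<in>carrier (T_ring H D). T_diff H (conj_tensor H a X) = conj_tensor H a (T_diff H X)) \<and>
       (\<forall>X\<in>cocycles H D. conj_cohomology H D a (cohomology_class H D X)
                           = cohomology_class H D (conj_tensor H a X))) \<and>
    group_action (grouplike_group H) (carrier (cohomology_ring H D))
      (\<lambda>a. restrict (conj_cohomology H D a) (carrier (cohomology_ring H D))) \<and>
    (\<forall>a\<in>carrier (grouplike_group H). graded_algebra_automorphism H D (conj_cohomology H D a))"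
proof (intro ballI)
  interpret hopf_algebra H by fact
  fix D assume D: "D \<in> {grouplike_algebra H, ground_algebra H}"
  have stable: "conj_by a ` D \<subseteq> D" if "a \<in> grouplikes H" for a
  proof -
    have "(\<lambda>x. a * x * antipode H a) ` D \<subseteq> D"
      using D that conj_grouplike_algebra[of a "antipode H a"] conj_ground_algebra[of a "antipode H a"]
      by (elim insertE) (simp_all add: grouplike_antipode grouplike_antipode_mult)
    with that show ?thesis by (simp add: grouplike_inv)
  qed
  show "(\<forall>a\<in>carrier (grouplike_group H).
       (\<forall>n. \<forall>X\<in>T_degree H D n. conj_tensor H a X \<in> T_degree H D n) \<and>
       (\<forall>X\<in>carrier (T_ring H D). T_diff H (conj_tensor H a X) = conj_tensor H a (T_diff H X)) \<and>
       (\<forall>X\<in>cocycles H D. conj_cohomology H D a (cohomology_class H D X)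
                           = cohomology_class H D (conj_tensor H a X))) \<and>
    group_action (grouplike_group H) (carrier (cohomology_ring H D))
      (\<lambda>a. restrict (conj_cohomology H D a) (carrier (cohomology_ring H D))) \<and>
    (\<forall>a\<in>carrier (grouplike_group H). graded_algebra_automorphism H D (conj_cohomology H D a))"
    unfolding grouplike_group_simps
  proof (intro conjI ballI allI)
    fix a assume a: "a \<in> grouplikes H"
    note endo = conj_by_endo[OF a] stable[OF a]
    show "conj_tensor H a X \<in> T_degree H D n" if "X \<in> T_degree H D n" for X n
      unfolding conj_tensor_tmap using tmap_T_degree[OF endo that] .
    show "T_diff H (conj_tensor H a X) = conj_tensor H a (T_diff H X)" if "X \<in> carrier (T_ring H D)" for X
      unfolding conj_tensor_tmap using tmap_T_diff_T_ring[OF endo that] .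
    show "conj_cohomology H D a (cohomology_class H D X) = cohomology_class H D (conj_tensor H a X)"
      if "X \<in> cocycles H D" for X
      unfolding conj_tensor_tmap conj_cohomology_induced
      using induced_class[OF endo cocycles_tensor[OF that]] .
    show "graded_algebra_automorphism H D (conj_cohomology H D a)"
      using conj_automorphism[OF stable a] .
  qed (rule conj_group_action[OF stable])
qed

end
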